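(* Let $k$ be a commutative associative ring with unit and let $H$ be a unital $k$-algebra with a coassociative comultiplication. Then the $H$-von Neumann regular radical $r_{Hn}$ is an $H$-radical property for $H$-module algebras (where the $r_{Hn}$-$H$-ideals are the $H$-regular ideals). That is: (R1) every $H$-homomorphic image of an $H$-regular $H$-module algebra is $H$-regular; (R2) every $H$-module algebra $R$ has a largest $H$-regular ideal, namely $r_{Hn}(R)$; (R3) $R/r_{Hn}(R)$ has no non-zero $H$-regular ideals. Moreover $r_{nH}\le r_{Hn}$, i.e. $r_{nH}(R)\subseteq r_{Hn}(R)$ for every $H$-module algebra $R$.
   Context: Algebras over $k$ are associative and need not have a unit. Write $\Delta(h)=\sum h_1\otimes h_2$ for the comultiplication $\Delta:H\to H\otimes H$ (a $k$-module homomorphism). An $H$-module algebra is a $k$-algebra $R$ that is a left $H$-module with $1_H\cdot a=a$ and $h\cdot(ab)=\sum(h_1\cdot a)(h_2\cdot b)$ for $a,b\in R$, $h\in H$. An $H$-ideal of $R$ is a two-sided ideal $I$ with $h\cdot I\subseteq I$ for all $h\in H$. An $H$-homomorphism is an algebra homomorphism commuting with the $H$-actions. An element $a\in R$ is $H$-regular if $a\in(H\cdot a)R(H\cdot a)$, i.e. $a=\sum_i(h_i\cdot a)b_i(h_i'\cdot a)$ (finite sum) with $h_i,h_i'\in H$, $b_i\in R$. $R$ is $H$-regular if all its elements are $H$-regular; an $H$-ideal $I$ of $R$ is an $H$-regular ideal if every element of $I$ is $H$-regular. Define $$r_{Hn}(R)=\{a\in R\mid \text{the } H\text{-ideal } (a)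 \text{ of } R \text{ generated by } a \text{ is } H\text{-regular}\}.$$ Let $r_n(R)$ be the von Neumann regular radical of $R$ (the largest ideal all of whose elements $a$ satisfy $a\in aRa$), and $r_{nH}(R)=(r_n(R):H)=\{x\in R\mid h\cdot x\in r_n(R)\text{ for all }h\in H\}$. *)

theory Defs
  imports "HOL-Algebra.QuotRing" "HOL-Algebra.Module" "HOL-Algebra.Generated_Groups"
    "HOL-Algebra.Free_Abelian_Groups"
begin

section \<open>Tensor products of modules over a commutative ring\<close>

definition linear_map ::
    "('k, 'a) ring_scheme \<Rightarrow> ('k, 'm, 'b) module_scheme \<Rightarrow> ('k, 'n, 'c) module_scheme
      \<Rightarrow> ('m \<Rightarrow> 'n) \<Rightarrow> bool"
  where "linear_map K M N f \<longleftrightarrow>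
    f \<in> carrier M \<rightarrow> carrier N \<and>
    (\<forall>x\<in>carrier M. \<forall>y\<in>carrier M. f (x \<oplus>\<^bsub>M\<^esub> y) = f x \<oplus>\<^bsub>N\<^esub> f y) \<and>
    (\<forall>c\<in>carrier K. \<forall>x\<in>carrier M. f (c \<odot>\<^bsub>M\<^esub> x) = c \<odot>\<^bsub>N\<^esub> f x)"

text \<open>
  The tensor product \<open>M \<otimes>\<^sub>K N\<close> is the free abelian group on \<open>carrier M \<times> carrier N\<close> modulo the
  subgroup generated by the biadditivity and \<open>K\<close>-balancing relators. Its elements are cosets
  of formal integer combinations of pairs, and \<open>K\<close> acts through the first factor.
\<close>

abbreviation tensor_free ::
    "('k, 'm, 'b) module_scheme \<Rightarrow> ('k, 'n, 'c) module_scheme \<Rightarrow> ('m \<times> 'n \<Rightarrow>\<^sub>0 int) monoid"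
  where "tensor_free M N \<equiv> free_Abelian_group (carrier M \<times> carrier N)"

definition tensor_relators ::
    "('k, 'a) ring_scheme \<Rightarrow> ('k, 'm, 'b) module_scheme \<Rightarrow> ('k, 'n, 'c) module_scheme
      \<Rightarrow> ('m \<times> 'n \<Rightarrow>\<^sub>0 int) set"
  where "tensor_relators K M N =
    {frag_of (x \<oplus>\<^bsub>M\<^esub> x', y) - frag_of (x, y) - frag_of (x', y) | x x' y.
       x \<in> carrier M \<and> x' \<in> carrier M \<and> y \<in> carrier N} \<union>
    {frag_of (x, y \<oplus>\<^bsub>N\<^esub> y') - frag_of (x, y) - frag_of (x, y') | x y y'.
       x \<in> carrier M \<and> y \<in> carrier N \<and> y' \<in> carrier N} \<union>
    {frag_of (c \<odot>\<^bsub>M\<^esub> x, y) - frag_of (x, c \<odot>\<^bsub>N\<^esub> y) | c x y.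
       c \<in> carrier K \<and> x \<in> carrier M \<and> y \<in> carrier N}"

definition tensor_kernel ::
    "('k, 'a) ring_scheme \<Rightarrow> ('k, 'm, 'b) module_scheme \<Rightarrow> ('k, 'n, 'c) module_scheme
      \<Rightarrow> ('m \<times> 'n \<Rightarrow>\<^sub>0 int) set"
  where "tensor_kernel K M N = generate (tensor_free M N) (tensor_relators K M N)"

definition tensor_class ::
    "('k, 'a) ring_scheme \<Rightarrow> ('k, 'm, 'b) module_scheme \<Rightarrow> ('k, 'n, 'c) module_scheme
      \<Rightarrow> ('m \<times> 'n \<Rightarrow>\<^sub>0 int) \<Rightarrow> ('m \<times> 'n \<Rightarrow>\<^sub>0 int) set"
  where "tensor_class K M N u = tensor_kernel K M N #>\<^bsub>tensor_free M N\<^esub> u"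

text \<open>
  A tensor product is only used as a module: the ring fields \<open>mult\<close> and \<open>one\<close> carry no meaning.
\<close>

definition tensor ::
    "('k, 'a) ring_scheme \<Rightarrow> ('k, 'm, 'b) module_scheme \<Rightarrow> ('k, 'n, 'c) module_scheme
      \<Rightarrow> ('k, ('m \<times> 'n \<Rightarrow>\<^sub>0 int) set) module"
  where "tensor K M N =
    \<lparr>carrier = carrier (tensor_free M N Mod tensor_kernel K M N),
     mult = undefined,
     one = undefined,
     ring.zero = \<one>\<^bsub>tensor_free M N Mod tensor_kernel K M N\<^esub>,
     add = (\<otimes>\<^bsub>tensor_free M N Mod tensor_kernel K M N\<^esub>),
     smult = (\<lambda>c C. \<Union>u\<in>C. tensor_class K M N (frag_extend (\<lambda>(x, y). frag_of (c \<odot>\<^bsub>M\<^esub> x, y)) u))\<rparr>"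

definition pure_tensor ::
    "('k, 'a) ring_scheme \<Rightarrow> ('k, 'm, 'b) module_scheme \<Rightarrow> ('k, 'n, 'c) module_scheme
      \<Rightarrow> 'm \<Rightarrow> 'n \<Rightarrow> ('m \<times> 'n \<Rightarrow>\<^sub>0 int) set"
  where "pure_tensor K M N x y = tensor_class K M N (frag_of (x, y))"

text \<open>
  \<open>tensor_lift P \<beta> t\<close> is \<open>\<Sum> \<beta> x y\<close> for \<open>t = \<Sum> x \<otimes> y\<close>. All representatives of \<open>t\<close> give the
  same value when \<open>\<beta>\<close> is biadditive and balanced, and it is only used for such \<open>\<beta>\<close>.
\<close>

definition tensor_eval ::
    "('p, 'd) ring_scheme \<Rightarrow> ('m \<Rightarrow> 'n \<Rightarrow> 'p) \<Rightarrow> ('m \<times> 'n \<Rightarrow>\<^sub>0 int) \<Rightarrow> 'p"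
  where "tensor_eval P \<beta> u =
    (\<Oplus>\<^bsub>P\<^esub>p\<in>Poly_Mapping.keys u. [Poly_Mapping.lookup u p] \<cdot>\<^bsub>P\<^esub> \<beta> (fst p) (snd p))"

definition tensor_lift ::
    "('p, 'd) ring_scheme \<Rightarrow> ('m \<Rightarrow> 'n \<Rightarrow> 'p) \<Rightarrow> ('m \<times> 'n \<Rightarrow>\<^sub>0 int) set \<Rightarrow> 'p"
  where "tensor_lift P \<beta> t = the_elem (tensor_eval P \<beta> ` t)"

text \<open>\<open>f \<otimes> g\<close>, where \<open>M\<close> and \<open>N\<close> are the codomains of \<open>f\<close> and \<open>g\<close>.\<close>

definition tensor_map ::
    "('k, 'a) ring_scheme \<Rightarrow> ('k, 'm, 'b) module_scheme \<Rightarrow> ('k, 'n, 'c) module_scheme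
      \<Rightarrow> ('p \<Rightarrow> 'm) \<Rightarrow> ('q \<Rightarrow> 'n) \<Rightarrow> ('p \<times> 'q \<Rightarrow>\<^sub>0 int) set \<Rightarrow> ('m \<times> 'n \<Rightarrow>\<^sub>0 int) set"
  where "tensor_map K M N f g = tensor_lift (tensor K M N) (\<lambda>x y. pure_tensor K M N (f x) (g y))"

text \<open>The associator \<open>(L \<otimes> M) \<otimes> N \<rightarrow> L \<otimes> (M \<otimes> N)\<close>, \<open>(x \<otimes> y) \<otimes> z \<mapsto> x \<otimes> (y \<otimes> z)\<close>.\<close>

definition tensor_assoc ::
    "('k, 'a) ring_scheme \<Rightarrow> ('k, 'l, 'b) module_scheme \<Rightarrow> ('k, 'm, 'c) module_scheme
      \<Rightarrow> ('k, 'n, 'd) module_scheme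
      \<Rightarrow> (('l \<times> 'm \<Rightarrow>\<^sub>0 int) set \<times> 'n \<Rightarrow>\<^sub>0 int) set
      \<Rightarrow> ('l \<times> ('m \<times> 'n \<Rightarrow>\<^sub>0 int) set \<Rightarrow>\<^sub>0 int) set"
  where "tensor_assoc K L M N =
    tensor_lift (tensor K L (tensor K M N))
      (\<lambda>s z. tensor_lift (tensor K L (tensor K M N))
         (\<lambda>x y. pure_tensor K L (tensor K M N) x (pure_tensor K M N y z)) s)"


section \<open>Algebras with comultiplication and their module algebras\<close>

text \<open>
  Algebras need not have a unit: the record field \<open>one\<close> of \<open>A\<close> is unconstrained here.
\<close>

locale nonunital_algebra = module K A for K (structure) and A (structure) +
  assumes mult_closed: "\<lbrakk>x \<in> carrier A; y \<in> carrier A\<rbrakk> \<Longrightarrow> x \<otimes>\<^bsub>A\<^esub> y \<in> carrier A"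
    and mult_assoc: "\<lbrakk>x \<in> carrier A; y \<in> carrier A; z \<in> carrier A\<rbrakk>
      \<Longrightarrow> (x \<otimes>\<^bsub>A\<^esub> y) \<otimes>\<^bsub>A\<^esub> z = x \<otimes>\<^bsub>A\<^esub> (y \<otimes>\<^bsub>A\<^esub> z)"
    and mult_l_distr: "\<lbrakk>x \<in> carrier A; y \<in> carrier A; z \<in> carrier A\<rbrakk>
      \<Longrightarrow> (x \<oplus>\<^bsub>A\<^esub> y) \<otimes>\<^bsub>A\<^esub> z = x \<otimes>\<^bsub>A\<^esub> z \<oplus>\<^bsub>A\<^esub> y \<otimes>\<^bsub>A\<^esub> z"
    and mult_r_distr: "\<lbrakk>x \<in> carrier A; y \<in> carrier A; z \<in> carrier A\<rbrakk>
      \<Longrightarrow> z \<otimes>\<^bsub>A\<^esub> (x \<oplus>\<^bsub>A\<^esub> y) = z \<otimes>\<^bsub>A\<^esub> x \<oplus>\<^bsub>A\<^esub> z \<otimes>\<^bsub>A\<^esub> y"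
    and smult_mult_left: "\<lbrakk>c \<in> carrier K; x \<in> carrier A; y \<in> carrier A\<rbrakk>
      \<Longrightarrow> (c \<odot>\<^bsub>A\<^esub> x) \<otimes>\<^bsub>A\<^esub> y = c \<odot>\<^bsub>A\<^esub> (x \<otimes>\<^bsub>A\<^esub> y)"
    and smult_mult_right: "\<lbrakk>c \<in> carrier K; x \<in> carrier A; y \<in> carrier A\<rbrakk>
      \<Longrightarrow> x \<otimes>\<^bsub>A\<^esub> (c \<odot>\<^bsub>A\<^esub> y) = c \<odot>\<^bsub>A\<^esub> (x \<otimes>\<^bsub>A\<^esub> y)"

text \<open>
  No counit is required, and \<open>\<Delta>\<close> is only assumed to be \<open>K\<close>-linear, not multiplicative.
\<close>

locale comult_algebra = H: nonunital_algebra K H + H: ring H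
    for K (structure) and H (structure) +
  fixes \<Delta>
  assumes comult_linear: "linear_map K H (tensor K H H) \<Delta>"
    and coassoc: "h \<in> carrier H \<Longrightarrow>
      tensor_assoc K H H H (tensor_map K (tensor K H H) H \<Delta> id (\<Delta> h)) =
      tensor_map K H (tensor K H H) id \<Delta> (\<Delta> h)"

record ('k, 'h, 'r) hmodule = "('k, 'r) module" +
  hact :: "'h \<Rightarrow> 'r \<Rightarrow> 'r"  (infixr \<open>\<rightharpoonup>\<index>\<close> 75)

text \<open>
  \<open>hact_smult\<close> says that the \<open>K\<close>-module structure of \<open>R\<close> is the one induced from \<open>H\<close>.
  Together with \<open>hact_mult\<close> and \<open>hact_one\<close> it makes each \<open>h \<rightharpoonup> _\<close> a \<open>K\<close>-linear map.
\<close>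

locale H_module_algebra = comult_algebra K H \<Delta> + R: nonunital_algebra K R
    for K (structure) and H (structure) and \<Delta> and R (structure) +
  assumes hact_closed: "\<lbrakk>h \<in> carrier H; x \<in> carrier R\<rbrakk> \<Longrightarrow> h \<rightharpoonup>\<^bsub>R\<^esub> x \<in> carrier R"
    and hact_l_distr: "\<lbrakk>g \<in> carrier H; h \<in> carrier H; x \<in> carrier R\<rbrakk>
      \<Longrightarrow> (g \<oplus>\<^bsub>H\<^esub> h) \<rightharpoonup>\<^bsub>R\<^esub> x = (g \<rightharpoonup>\<^bsub>R\<^esub> x) \<oplus>\<^bsub>R\<^esub> (h \<rightharpoonup>\<^bsub>R\<^esub> x)"
    and hact_r_distr: "\<lbrakk>h \<in> carrier H; x \<in> carrier R; y \<in> carrier R\<rbrakk>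
      \<Longrightarrow> h \<rightharpoonup>\<^bsub>R\<^esub> (x \<oplus>\<^bsub>R\<^esub> y) = (h \<rightharpoonup>\<^bsub>R\<^esub> x) \<oplus>\<^bsub>R\<^esub> (h \<rightharpoonup>\<^bsub>R\<^esub> y)"
    and hact_mult: "\<lbrakk>g \<in> carrier H; h \<in> carrier H; x \<in> carrier R\<rbrakk>
      \<Longrightarrow> (g \<otimes>\<^bsub>H\<^esub> h) \<rightharpoonup>\<^bsub>R\<^esub> x = g \<rightharpoonup>\<^bsub>R\<^esub> (h \<rightharpoonup>\<^bsub>R\<^esub> x)"
    and hact_one: "x \<in> carrier R \<Longrightarrow> \<one>\<^bsub>H\<^esub> \<rightharpoonup>\<^bsub>R\<^esub> x = x"
    and hact_smult: "\<lbrakk>c \<in> carrier K; h \<in> carrier H; x \<in> carrier R\<rbrakk>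
      \<Longrightarrow> (c \<odot>\<^bsub>H\<^esub> h) \<rightharpoonup>\<^bsub>R\<^esub> x = c \<odot>\<^bsub>R\<^esub> (h \<rightharpoonup>\<^bsub>R\<^esub> x)"
    and hact_prod: "\<lbrakk>h \<in> carrier H; x \<in> carrier R; y \<in> carrier R\<rbrakk>
      \<Longrightarrow> h \<rightharpoonup>\<^bsub>R\<^esub> (x \<otimes>\<^bsub>R\<^esub> y) =
          tensor_lift R (\<lambda>h1 h2. (h1 \<rightharpoonup>\<^bsub>R\<^esub> x) \<otimes>\<^bsub>R\<^esub> (h2 \<rightharpoonup>\<^bsub>R\<^esub> y)) (\<Delta> h)"

definition H_hom ::
    "('k, 'a) ring_scheme \<Rightarrow> ('k, 'h, 'b) module_scheme \<Rightarrow> ('k, 'h, 'r, 'c) hmodule_scheme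
      \<Rightarrow> ('k, 'h, 's, 'd) hmodule_scheme \<Rightarrow> ('r \<Rightarrow> 's) \<Rightarrow> bool"
  where "H_hom K H R S f \<longleftrightarrow>
    linear_map K R S f \<and>
    (\<forall>x\<in>carrier R. \<forall>y\<in>carrier R. f (x \<otimes>\<^bsub>R\<^esub> y) = f x \<otimes>\<^bsub>S\<^esub> f y) \<and>
    (\<forall>h\<in>carrier H. \<forall>x\<in>carrier R. f (h \<rightharpoonup>\<^bsub>R\<^esub> x) = h \<rightharpoonup>\<^bsub>S\<^esub> f x)"


section \<open>Ideals and quotients\<close>

definition algebra_ideal ::
    "('k, 'a) ring_scheme \<Rightarrow> ('k, 'r, 'b) module_scheme \<Rightarrow> 'r set \<Rightarrow> bool"
  where "algebra_ideal K R I \<longleftrightarrow>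
    submodule I K R \<and>
    (\<forall>x\<in>I. \<forall>r\<in>carrier R. x \<otimes>\<^bsub>R\<^esub> r \<in> I \<and> r \<otimes>\<^bsub>R\<^esub> x \<in> I)"

definition H_ideal ::
    "('k, 'a) ring_scheme \<Rightarrow> ('k, 'h, 'b) module_scheme \<Rightarrow> ('k, 'h, 'r, 'c) hmodule_scheme
      \<Rightarrow> 'r set \<Rightarrow> bool"
  where "H_ideal K H R I \<longleftrightarrow>
    algebra_ideal K R I \<and> (\<forall>h\<in>carrier H. \<forall>x\<in>I. h \<rightharpoonup>\<^bsub>R\<^esub> x \<in> I)"

definition H_ideal_gen ::
    "('k, 'a) ring_scheme \<Rightarrow> ('k, 'h, 'b) module_scheme \<Rightarrow> ('k, 'h, 'r, 'c) hmodule_scheme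
      \<Rightarrow> 'r \<Rightarrow> 'r set"
  where "H_ideal_gen K H R a = \<Inter>{I. H_ideal K H R I \<and> a \<in> I}"

text \<open>
  \<open>R Quot I\<close> is the record of additive cosets; its \<open>one\<close> carries no meaning for non-unital \<open>R\<close>.
\<close>

definition H_quotient ::
    "('k, 'h, 'r, 'c) hmodule_scheme \<Rightarrow> 'r set \<Rightarrow> ('k, 'h, 'r set) hmodule"
  where "H_quotient R I =
    \<lparr>carrier = carrier (R Quot I),
     mult = (\<otimes>\<^bsub>R Quot I\<^esub>),
     one = \<one>\<^bsub>R Quot I\<^esub>,
     ring.zero = \<zero>\<^bsub>R Quot I\<^esub>,
     add = (\<oplus>\<^bsub>R Quot I\<^esub>),
     smult = (\<lambda>c C. \<Union>x\<in>C. I +>\<^bsub>R\<^esub> (c \<odot>\<^bsub>R\<^esub> x)),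
     hact = (\<lambda>h C. \<Union>x\<in>C. I +>\<^bsub>R\<^esub> (h \<rightharpoonup>\<^bsub>R\<^esub> x))\<rparr>"


section \<open>Regularity and the radicals\<close>

definition H_regular_element ::
    "('k, 'h, 'b) module_scheme \<Rightarrow> ('k, 'h, 'r, 'c) hmodule_scheme \<Rightarrow> 'r \<Rightarrow> bool"
  where "H_regular_element H R a \<longleftrightarrow>
    (\<exists>n::nat. \<exists>g g' b.
      (\<forall>i<n. g i \<in> carrier H \<and> g' i \<in> carrier H \<and> b i \<in> carrier R) \<and>
      a = (\<Oplus>\<^bsub>R\<^esub>i\<in>{..<n}. ((g i \<rightharpoonup>\<^bsub>R\<^esub> a) \<otimes>\<^bsub>R\<^esub> b i) \<otimes>\<^bsub>R\<^esub> (g' i \<rightharpoonup>\<^bsub>R\<^esub> a)))"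

definition H_regular_algebra ::
    "('k, 'h, 'b) module_scheme \<Rightarrow> ('k, 'h, 'r, 'c) hmodule_scheme \<Rightarrow> bool"
  where "H_regular_algebra H R \<longleftrightarrow> (\<forall>a\<in>carrier R. H_regular_element H R a)"

definition H_regular_ideal ::
    "('k, 'a) ring_scheme \<Rightarrow> ('k, 'h, 'b) module_scheme \<Rightarrow> ('k, 'h, 'r, 'c) hmodule_scheme
      \<Rightarrow> 'r set \<Rightarrow> bool"
  where "H_regular_ideal K H R I \<longleftrightarrow> H_ideal K H R I \<and> (\<forall>a\<in>I. H_regular_element H R a)"

definition r_Hn ::
    "('k, 'a) ring_scheme \<Rightarrow> ('k, 'h, 'b) module_scheme \<Rightarrow> ('k, 'h, 'r, 'c) hmodule_scheme
      \<Rightarrow> 'r set"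
  where "r_Hn K H R = {a \<in> carrier R. H_regular_ideal K H R (H_ideal_gen K H R a)}"

definition vN_regular_ideal ::
    "('k, 'a) ring_scheme \<Rightarrow> ('k, 'r, 'b) module_scheme \<Rightarrow> 'r set \<Rightarrow> bool"
  where "vN_regular_ideal K R I \<longleftrightarrow>
    algebra_ideal K R I \<and> (\<forall>a\<in>I. \<exists>b\<in>carrier R. a = (a \<otimes>\<^bsub>R\<^esub> b) \<otimes>\<^bsub>R\<^esub> a)"

text \<open>
  The largest element with respect to inclusion; it exists in every associative algebra
  by the theorem of Brown and McCoy.
\<close>

definition r_n :: "('k, 'a) ring_scheme \<Rightarrow> ('k, 'r, 'b) module_scheme \<Rightarrow> 'r set"
  where "r_n K R = (GREATEST I. vN_regular_ideal K R I)"

definition r_nH ::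
    "('k, 'a) ring_scheme \<Rightarrow> ('k, 'h, 'b) module_scheme \<Rightarrow> ('k, 'h, 'r, 'c) hmodule_scheme
      \<Rightarrow> 'r set"
  where "r_nH K H R = {x \<in> carrier R. \<forall>h\<in>carrier H. h \<rightharpoonup>\<^bsub>R\<^esub> x \<in> r_n K R}"

end

theory Submission
  imports Defs
begin

text \<open>
  An element \<open>a\<close> is \<open>H\<close>-regular iff it lies in the additive group \<open>T(a) = (H \<cdot> a) R (H \<cdot> a)\<close>.
  Since \<open>h \<cdot> (x y)\<close> is a sum of products \<open>(h\<^sub>1 \<cdot> x) (h\<^sub>2 \<cdot> y)\<close>, the group \<open>T(a)\<close> is
  \<open>H\<close>-stable, so \<open>T(a + t) \<subseteq> T(a)\<close> for \<open>t \<in> T(a)\<close>. Hence \<open>a\<close> is \<open>H\<close>-regular as soon as some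
  such \<open>a + t\<close> is, which is the \<open>H\<close>-analogue of the Brown-McCoy argument: an element that is
  \<open>H\<close>-regular modulo an \<open>H\<close>-regular ideal is \<open>H\<close>-regular. It follows that sums of \<open>H\<close>-regular
  ideals are \<open>H\<close>-regular, that \<open>r\<^sub>H\<^sub>n(R)\<close> is the union of all of them, and that the quotient
  by it has no further ones.
\<close>

subsection \<open>Additive groups\<close>

text \<open>Von Neumann regularity produces one \<open>e\<close> with \<open>a = a e a\<close>. An
  \<open>H\<close>-regular \<open>a\<close> is only a sum of products with varying \<open>g\<close>
  and \<open>g'\<close>, so no such closed formula is at hand; the proof asks for membership in an
  additive subgroup instead. This also tames \<open>\<Delta>\<close>: a Sweedler sum is never
  expanded, it is only known to lie in every additive subgroup that contains all products of
  \<open>h1 . x\<close> with \<open>h2 . y\<close>. Reduction modulo an ideal works by transport. A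
  surjective \<open>H\<close>-homomorphism \<open>f\<close> maps \<open>T(a)\<close> onto
  \<open>T(f a)\<close>, so an element that is regular modulo \<open>N\<close> differs from some
  \<open>t\<close> in \<open>T(a)\<close> by an element of \<open>N\<close>. This asks of the
  quotient only an additive group structure and the projection onto it. The comparison with
  \<open>r_nH\<close> rests on a classical fact: \<open>r_n\<close> is introduced as a greatest
  ideal, so its existence has to be proved, here for algebras without unit.\<close>

lemma hom_generate_subset:
  assumes "group G" "group G'" "f \<in> hom G G'" "S \<subseteq> carrier G" "subgroup A G'" "f ` S \<subseteq> A"
  shows "f ` generate G S \<subseteq> A"
proof -
  interpret group_hom G G' f
    using assms by (simp add: group_hom_def group_hom_axioms_def)
  show ?thesis
    using generate_img[OF assms(4)] H.generate_subgroup_incl[OF assms(6,5)] by simp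
qed

context abelian_group
begin

lemma subgroup_a_closed: "\<lbrakk>subgroup A (add_monoid G); x \<in> A; y \<in> A\<rbrakk> \<Longrightarrow> x \<oplus> y \<in> A"
  using subgroup.m_closed by fastforce

lemma subgroup_zero_closed: "subgroup A (add_monoid G) \<Longrightarrow> \<zero> \<in> A"
  using subgroup.one_closed by fastforce

lemma subgroup_a_inv_closed: "\<lbrakk>subgroup A (add_monoid G); x \<in> A\<rbrakk> \<Longrightarrow> \<ominus> x \<in> A"
  using subgroup.m_inv_closed[of A "add_monoid G" x] by (simp add: a_inv_def)

lemma subgroup_minus_closed: "\<lbrakk>subgroup A (add_monoid G); x \<in> A; y \<in> A\<rbrakk> \<Longrightarrow> x \<ominus> y \<in> A"
  by (simp add: a_minus_def subgroup_a_closed subgroup_a_inv_closed)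

lemma subgroup_in_carrier: "\<lbrakk>subgroup A (add_monoid G); x \<in> A\<rbrakk> \<Longrightarrow> x \<in> carrier G"
  using subgroup.subset by fastforce

lemma add_subgroupI:
  assumes "A \<subseteq> carrier G" "\<zero> \<in> A" "\<And>x. x \<in> A \<Longrightarrow> \<ominus> x \<in> A"
    and "\<And>x y. \<lbrakk>x \<in> A; y \<in> A\<rbrakk> \<Longrightarrow> x \<oplus> y \<in> A"
  shows "subgroup A (add_monoid G)"
  using assms by (unfold_locales) (auto simp: a_inv_def[symmetric])

lemma finsum_in_subgroup:
  assumes "subgroup A (add_monoid G)" "\<And>i. i \<in> F \<Longrightarrow> f i \<in> A"
  shows "finsum G f F \<in> A"
proof (cases "finite F")
  case True
  then show ?thesis
    using assms(2)
  proof (induction F)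
    case (insert i F)
    then have "f \<in> F \<rightarrow> carrier G" "f i \<in> carrier G"
      using subgroup_in_carrier[OF assms(1)] by auto
    then show ?case
      using insert by (simp add: subgroup_a_closed[OF assms(1)])
  qed (simp add: subgroup_zero_closed[OF assms(1)])
qed (simp add: subgroup_zero_closed[OF assms(1)] finsum_infinite)

end


subsection \<open>Evaluating balanced maps on tensors\<close>

context abelian_group
begin

text \<open>Keys may cancel in a sum \<open>u + v\<close>. Padding with zero coefficients lets the
  evaluations of \<open>u\<close>, \<open>v\<close> and \<open>u + v\<close> run over one common
  index set.\<close>

lemma tensor_eval_superset:
  assumes "finite F" "Poly_Mapping.keys u \<subseteq> F" "\<And>p. p \<in> F \<Longrightarrow> \<beta> (fst p) (snd p) \<in> carrier G"
  shows "tensor_eval G \<beta> u = (\<Oplus>p\<in>F. [Poly_Mapping.lookup u p] \<cdot> \<beta> (fst p) (snd p))"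
proof -
  have "add_pow G (0::int) x = \<zero>" for x
    by (simp add: add_pow_def)
  then show ?thesis
    unfolding tensor_eval_def using assms
    by (intro add.finprod_mono_neutral_cong_left) (auto simp: in_keys_iff)
qed

lemma tensor_eval_hom:
  assumes "\<And>x y. \<lbrakk>x \<in> X; y \<in> Y\<rbrakk> \<Longrightarrow> \<beta> x y \<in> carrier G"
  shows "tensor_eval G \<beta> \<in> hom (free_Abelian_group (X \<times> Y)) (add_monoid G)"
proof (rule homI)
  fix u assume "u \<in> carrier (free_Abelian_group (X \<times> Y))"
  then show "tensor_eval G \<beta> u \<in> carrier (add_monoid G)"
    unfolding tensor_eval_def using assms
    by (auto intro!: finsum_closed add.int_pow_closed)
next
  fix u v
  assume "u \<in> carrier (free_Abelian_group (X \<times> Y))" "v \<in> carrier (free_Abelian_group (X \<times> Y))"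
  then have uv: "Poly_Mapping.keys u \<subseteq> X \<times> Y" "Poly_Mapping.keys v \<subseteq> X \<times> Y"
    by auto
  let ?F = "Poly_Mapping.keys u \<union> Poly_Mapping.keys v"
  have \<beta>: "\<beta> (fst p) (snd p) \<in> carrier G" if "p \<in> ?F" for p
    using that uv assms by auto
  have "tensor_eval G \<beta> (u + v) =
      (\<Oplus>p\<in>?F. [Poly_Mapping.lookup (u + v) p] \<cdot> \<beta> (fst p) (snd p))"
    by (rule tensor_eval_superset) (use \<beta> keys_add[of u v] in auto)
  also have "\<dots> = (\<Oplus>p\<in>?F. [Poly_Mapping.lookup u p] \<cdot> \<beta> (fst p) (snd p) \<oplus>
      [Poly_Mapping.lookup v p] \<cdot> \<beta> (fst p) (snd p))"
    using \<beta> by (intro finsum_cong') (auto simp: lookup_add add.int_pow_mult)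
  also have "\<dots> = (\<Oplus>p\<in>?F. [Poly_Mapping.lookup u p] \<cdot> \<beta> (fst p) (snd p)) \<oplus>
      (\<Oplus>p\<in>?F. [Poly_Mapping.lookup v p] \<cdot> \<beta> (fst p) (snd p))"
    using \<beta> by (intro finsum_addf) auto
  also have "\<dots> = tensor_eval G \<beta> u \<oplus> tensor_eval G \<beta> v"
    using \<beta> tensor_eval_superset[of ?F u \<beta>] tensor_eval_superset[of ?F v \<beta>] by auto
  finally show "tensor_eval G \<beta> (u \<otimes>\<^bsub>free_Abelian_group (X \<times> Y)\<^esub> v) =
      tensor_eval G \<beta> u \<otimes>\<^bsub>add_monoid G\<^esub> tensor_eval G \<beta> v"
    by simp
qed

lemma tensor_eval_frag_of:
  assumes "\<beta> x y \<in> carrier G"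
  shows "tensor_eval G \<beta> (frag_of (x, y)) = \<beta> x y"
  using assms by (simp add: tensor_eval_def)

lemma tensor_eval_in_subgroup:
  assumes "subgroup A (add_monoid G)" "Poly_Mapping.keys u \<subseteq> X \<times> Y"
    and "\<And>x y. \<lbrakk>x \<in> X; y \<in> Y\<rbrakk> \<Longrightarrow> \<beta> x y \<in> A"
  shows "tensor_eval G \<beta> u \<in> A"
proof -
  have "[k] \<cdot> \<beta> (fst p) (snd p) \<in> A" if "p \<in> Poly_Mapping.keys u" for p and k :: int
  proof -
    have "\<beta> (fst p) (snd p) \<in> A"
      using that assms(2,3) by auto
    then show ?thesis
      using add.subgroup_int_pow_closed[OF assms(1)] by (simp add: add_pow_def)
  qed
  then show ?thesis
    unfolding tensor_eval_def by (intro finsum_in_subgroup[OF assms(1)])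
qed

end

text \<open>\<open>tensor_lift\<close> takes \<open>the_elem\<close> of the image of a coset, so
  that image must be a singleton. Evaluation is a homomorphism on the free abelian group, and it
  kills every relator when \<open>\<beta>\<close> is biadditive and balanced; hence it kills the
  kernel and is constant on \<open>t\<close>. The common value is an integer combination of values
  of \<open>\<beta>\<close>, all of which lie in \<open>A\<close>.\<close>

lemma (in module) tensor_lift_in_subgroup:
  assumes "abelian_group P" and L: "module R L"
    and A: "subgroup A (add_monoid P)" and t: "t \<in> carrier (tensor R L M)"
    and \<beta>: "\<And>x y. \<lbrakk>x \<in> carrier L; y \<in> carrier M\<rbrakk> \<Longrightarrow> \<beta> x y \<in> A"
    and add_left: "\<And>x x' y. \<lbrakk>x \<in> carrier L; x' \<in> carrier L; y \<in> carrier M\<rbrakk>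
      \<Longrightarrow> \<beta> (x \<oplus>\<^bsub>L\<^esub> x') y = \<beta> x y \<oplus>\<^bsub>P\<^esub> \<beta> x' y"
    and add_right: "\<And>x y y'. \<lbrakk>x \<in> carrier L; y \<in> carrier M; y' \<in> carrier M\<rbrakk>
      \<Longrightarrow> \<beta> x (y \<oplus>\<^bsub>M\<^esub> y') = \<beta> x y \<oplus>\<^bsub>P\<^esub> \<beta> x y'"
    and balanced: "\<And>c x y. \<lbrakk>c \<in> carrier R; x \<in> carrier L; y \<in> carrier M\<rbrakk>
      \<Longrightarrow> \<beta> (c \<odot>\<^bsub>L\<^esub> x) y = \<beta> x (c \<odot>\<^bsub>M\<^esub> y)"
  shows "tensor_lift P \<beta> t \<in> A"
proof -
  interpret P: abelian_group P by fact
  interpret L: module R L by fact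
  let ?F = "tensor_free L M" and ?e = "tensor_eval P \<beta>"
  have \<beta>_closed: "\<beta> x y \<in> carrier P" if "x \<in> carrier L" "y \<in> carrier M" for x y
    using \<beta>[OF that] P.subgroup_in_carrier[OF A] by simp
  interpret e: group_hom ?F "add_monoid P" ?e
    using P.tensor_eval_hom[of "carrier L" "carrier M" \<beta>] \<beta>_closed P.add.group_axioms
    by (simp add: group_hom_def group_hom_axioms_def)
  have e_add: "?e (v + w) = ?e v \<oplus>\<^bsub>P\<^esub> ?e w"
    if "Poly_Mapping.keys v \<subseteq> carrier L \<times> carrier M"
      "Poly_Mapping.keys w \<subseteq> carrier L \<times> carrier M" for v w
    using that e.hom_mult[of v w] by simp
  have e_diff: "?e (v - w) = ?e v \<ominus>\<^bsub>P\<^esub> ?e w"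
    if "Poly_Mapping.keys v \<subseteq> carrier L \<times> carrier M"
      "Poly_Mapping.keys w \<subseteq> carrier L \<times> carrier M" for v w
    using that e_add[of v "- w"] e.hom_inv[of w] by (simp add: a_minus_def a_inv_def keys_minus)
  have e_frag: "?e (frag_of (x, y)) = \<beta> x y" if "x \<in> carrier L" "y \<in> carrier M" for x y
    using that \<beta>_closed by (simp add: P.tensor_eval_frag_of)
  have keys_diff: "Poly_Mapping.keys (v - w) \<subseteq> carrier L \<times> carrier M"
    if "Poly_Mapping.keys v \<subseteq> carrier L \<times> carrier M"
      "Poly_Mapping.keys w \<subseteq> carrier L \<times> carrier M" for v w
    using that Poly_Mapping.keys_diff[of v w] by blast
  have rel_closed: "tensor_relators R L M \<subseteq> carrier ?F"
    unfolding tensor_relators_def by (auto dest!: subsetD[OF Poly_Mapping.keys_diff])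
  have cancel: "x \<oplus>\<^bsub>P\<^esub> y \<ominus>\<^bsub>P\<^esub> x \<ominus>\<^bsub>P\<^esub> y = \<zero>\<^bsub>P\<^esub>"
    if "x \<in> carrier P" "y \<in> carrier P" for x y
  proof -
    have "x \<oplus>\<^bsub>P\<^esub> y \<oplus>\<^bsub>P\<^esub> (\<ominus>\<^bsub>P\<^esub> x \<oplus>\<^bsub>P\<^esub> \<ominus>\<^bsub>P\<^esub> y) = \<zero>\<^bsub>P\<^esub>"
      using that by (simp flip: P.minus_add add: P.r_neg)
    then show ?thesis
      using that by (simp add: a_minus_def P.a_assoc)
  qed
  have "?e r = \<zero>\<^bsub>P\<^esub>" if "r \<in> tensor_relators R L M" for r
    using that unfolding tensor_relators_def
    by (auto simp: e_diff keys_diff e_frag add_left add_right balanced \<beta>_closed cancel)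
      (simp add: a_minus_def P.r_neg \<beta>_closed)
  then have "?e ` tensor_relators R L M \<subseteq> {\<zero>\<^bsub>P\<^esub>}"
    by auto
  then have ker: "?e ` tensor_kernel R L M \<subseteq> {\<zero>\<^bsub>P\<^esub>}"
    unfolding tensor_kernel_def
    using hom_generate_subset[OF group_free_Abelian_group P.a_group e.homh rel_closed]
      P.add.triv_subgroup by simp
  have ker_closed: "tensor_kernel R L M \<subseteq> carrier ?F"
    unfolding tensor_kernel_def by (rule e.G.generate_incl[OF rel_closed])
  obtain u where u: "u \<in> carrier ?F" and t_eq: "t = tensor_kernel R L M #>\<^bsub>?F\<^esub> u"
    using t by (auto simp: tensor_def FactGroup_def RCOSETS_def)
  have "?e w = ?e u" if w: "w \<in> t" for w
  proof -
    obtain n where n: "n \<in> tensor_kernel R L M" and "w = n + u"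
      using w unfolding t_eq by (auto simp: r_coset_def)
    moreover have "?e n = \<zero>\<^bsub>P\<^esub>" "n \<in> carrier ?F"
      using subsetD[OF ker imageI[OF n]] subsetD[OF ker_closed n] by simp_all
    ultimately show ?thesis
      using u e_add[of n u] e.hom_closed[OF u] by simp
  qed
  \<comment> \<open>Without a member of \<open>t\<close> the image would be empty instead of
    \<open>{?e u}\<close>.\<close>
  moreover have "u \<in> t"
    using t_eq generate.one[of ?F "tensor_relators R L M"]
    by (force simp: r_coset_def tensor_kernel_def)
  ultimately have "?e ` t = {?e u}"
    by blast
  then have "tensor_lift P \<beta> t = ?e u"
    by (simp add: tensor_lift_def)
  then show ?thesis
    using P.tensor_eval_in_subgroup[OF A _ \<beta>, of u "carrier L" "carrier M"] u by simp
qed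


subsection \<open>Ideals of non-unital algebras\<close>

context nonunital_algebra
begin

lemma mult_l_zero: "x \<in> carrier A \<Longrightarrow> \<zero>\<^bsub>A\<^esub> \<otimes>\<^bsub>A\<^esub> x = \<zero>\<^bsub>A\<^esub>"
  using mult_l_distr[of "\<zero>\<^bsub>A\<^esub>" "\<zero>\<^bsub>A\<^esub>" x] mult_closed[of "\<zero>\<^bsub>A\<^esub>" x]
  by (simp add: M.add.l_cancel_one)

lemma mult_r_zero: "x \<in> carrier A \<Longrightarrow> x \<otimes>\<^bsub>A\<^esub> \<zero>\<^bsub>A\<^esub> = \<zero>\<^bsub>A\<^esub>"
  using mult_r_distr[of "\<zero>\<^bsub>A\<^esub>" "\<zero>\<^bsub>A\<^esub>" x] mult_closed[of x "\<zero>\<^bsub>A\<^esub>"]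
  by (simp add: M.add.l_cancel_one)

lemma mult_l_minus:
  "\<lbrakk>x \<in> carrier A; y \<in> carrier A\<rbrakk> \<Longrightarrow> (\<ominus>\<^bsub>A\<^esub> x) \<otimes>\<^bsub>A\<^esub> y = \<ominus>\<^bsub>A\<^esub> (x \<otimes>\<^bsub>A\<^esub> y)"
  using mult_l_distr[of "\<ominus>\<^bsub>A\<^esub> x" x y]
  by (intro M.minus_equality[symmetric]) (auto simp: M.l_neg mult_l_zero mult_closed)

lemma mult_r_minus:
  "\<lbrakk>x \<in> carrier A; y \<in> carrier A\<rbrakk> \<Longrightarrow> x \<otimes>\<^bsub>A\<^esub> (\<ominus>\<^bsub>A\<^esub> y) = \<ominus>\<^bsub>A\<^esub> (x \<otimes>\<^bsub>A\<^esub> y)"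
  using mult_r_distr[of "\<ominus>\<^bsub>A\<^esub> y" y x]
  by (intro M.minus_equality[symmetric]) (auto simp: M.l_neg mult_r_zero mult_closed)

lemma algebra_idealD:
  assumes "algebra_ideal K A I"
  shows "subgroup I (add_monoid A)"
    and "I \<subseteq> carrier A" and "\<zero>\<^bsub>A\<^esub> \<in> I"
    and "x \<in> I \<Longrightarrow> \<ominus>\<^bsub>A\<^esub> x \<in> I"
    and "\<lbrakk>x \<in> I; y \<in> I\<rbrakk> \<Longrightarrow> x \<oplus>\<^bsub>A\<^esub> y \<in> I"
    and "\<lbrakk>x \<in> I; y \<in> I\<rbrakk> \<Longrightarrow> x \<ominus>\<^bsub>A\<^esub> y \<in> I"
    and "\<lbrakk>c \<in> carrier K; x \<in> I\<rbrakk> \<Longrightarrow> c \<odot>\<^bsub>A\<^esub> x \<in> I"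
    and "\<lbrakk>x \<in> I; r \<in> carrier A\<rbrakk> \<Longrightarrow> x \<otimes>\<^bsub>A\<^esub> r \<in> I"
    and "\<lbrakk>x \<in> I; r \<in> carrier A\<rbrakk> \<Longrightarrow> r \<otimes>\<^bsub>A\<^esub> x \<in> I"
proof -
  have sub: "submodule I K A" and "\<forall>x\<in>I. \<forall>r\<in>carrier A. x \<otimes>\<^bsub>A\<^esub> r \<in> I \<and> r \<otimes>\<^bsub>A\<^esub> x \<in> I"
    using assms by (auto simp: algebra_ideal_def)
  then show "subgroup I (add_monoid A)" "\<lbrakk>x \<in> I; r \<in> carrier A\<rbrakk> \<Longrightarrow> x \<otimes>\<^bsub>A\<^esub> r \<in> I"
    "\<lbrakk>x \<in> I; r \<in> carrier A\<rbrakk> \<Longrightarrow> r \<otimes>\<^bsub>A\<^esub> x \<in> I"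
    by (auto intro: submodule.axioms)
  then show "\<zero>\<^bsub>A\<^esub> \<in> I" "\<lbrakk>x \<in> I; y \<in> I\<rbrakk> \<Longrightarrow> x \<ominus>\<^bsub>A\<^esub> y \<in> I"
    by (auto intro: M.subgroup_zero_closed M.subgroup_minus_closed)
  show "I \<subseteq> carrier A" "x \<in> I \<Longrightarrow> \<ominus>\<^bsub>A\<^esub> x \<in> I" "\<lbrakk>x \<in> I; y \<in> I\<rbrakk> \<Longrightarrow> x \<oplus>\<^bsub>A\<^esub> y \<in> I"
    "\<lbrakk>c \<in> carrier K; x \<in> I\<rbrakk> \<Longrightarrow> c \<odot>\<^bsub>A\<^esub> x \<in> I"
    using submoduleE[OF sub] by auto
qed

lemma algebra_idealI:
  assumes "I \<subseteq> carrier A" "\<zero>\<^bsub>A\<^esub> \<in> I"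
    and "\<And>x y. \<lbrakk>x \<in> I; y \<in> I\<rbrakk> \<Longrightarrow> x \<oplus>\<^bsub>A\<^esub> y \<in> I"
    and "\<And>c x. \<lbrakk>c \<in> carrier K; x \<in> I\<rbrakk> \<Longrightarrow> c \<odot>\<^bsub>A\<^esub> x \<in> I"
    and "\<And>x r. \<lbrakk>x \<in> I; r \<in> carrier A\<rbrakk> \<Longrightarrow> x \<otimes>\<^bsub>A\<^esub> r \<in> I"
    and "\<And>x r. \<lbrakk>x \<in> I; r \<in> carrier A\<rbrakk> \<Longrightarrow> r \<otimes>\<^bsub>A\<^esub> x \<in> I"
  shows "algebra_ideal K A I"
proof -
  \<comment> \<open>Negation is multiplication by the scalar -1 of \<open>K\<close>, so closure
    under scalars yields additive inverses.\<close>
  have "\<ominus>\<^bsub>A\<^esub> x \<in> I" if "x \<in> I" for x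
    using assms(4)[of "\<ominus> \<one>" x] that assms(1) by (auto simp: smult_l_minus)
  then show ?thesis
    unfolding algebra_ideal_def using assms by (auto intro!: submoduleI)
qed

lemma algebra_ideal_zero: "algebra_ideal K A {\<zero>\<^bsub>A\<^esub>}"
  by (rule algebra_idealI) (auto simp: mult_l_zero mult_r_zero)

lemma algebra_ideal_carrier: "algebra_ideal K A (carrier A)"
  by (rule algebra_idealI) (auto simp: mult_closed)

lemma algebra_ideal_Inter:
  assumes "\<I> \<noteq> {}" "\<And>I. I \<in> \<I> \<Longrightarrow> algebra_ideal K A I"
  shows "algebra_ideal K A (\<Inter>\<I>)"
proof -
  note ideal = algebra_idealD[OF assms(2)]
  obtain J where "J \<in> \<I>"
    using assms(1) by blast
  then have "\<Inter>\<I> \<subseteq> carrier A"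
    using ideal(2) by blast
  then show ?thesis
    by (rule algebra_idealI) (auto intro: ideal)
qed

text \<open>Two elements of the union lie in a common member, where they can be added. Both radicals
  are unions of this kind, directed because regular ideals are closed under sums.\<close>

lemma algebra_ideal_Union_directed:
  assumes "\<I> \<noteq> {}" "\<And>I. I \<in> \<I> \<Longrightarrow> algebra_ideal K A I"
    and directed: "\<And>I J. \<lbrakk>I \<in> \<I>; J \<in> \<I>\<rbrakk> \<Longrightarrow> \<exists>L\<in>\<I>. I \<subseteq> L \<and> J \<subseteq> L"
  shows "algebra_ideal K A (\<Union>\<I>)"
proof (rule algebra_idealI)
  fix x y assume "x \<in> \<Union>\<I>" "y \<in> \<Union>\<I>"
  then obtain L where "L \<in> \<I>" "x \<in> L" "y \<in> L"
    using directed by blast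
  then show "x \<oplus>\<^bsub>A\<^esub> y \<in> \<Union>\<I>"
    using algebra_idealD(5)[OF assms(2)] by blast
next
  show "\<zero>\<^bsub>A\<^esub> \<in> \<Union>\<I>"
    using assms(1) algebra_idealD(3)[OF assms(2)] by blast
  show "\<Union>\<I> \<subseteq> carrier A"
    using algebra_idealD(2)[OF assms(2)] by blast
qed (use algebra_idealD(7-9)[OF assms(2)] in blast)+

lemma algebra_ideal_sum:
  assumes I: "algebra_ideal K A I" and J: "algebra_ideal K A J"
  shows "algebra_ideal K A (I <+>\<^bsub>A\<^esub> J)"
proof -
  note IJ = algebra_idealD[OF I] algebra_idealD[OF J]
  have carr: "x \<in> carrier A" if "x \<in> I \<or> x \<in> J" for x
    using that IJ(2,11) by blast
  have mem: "i \<oplus>\<^bsub>A\<^esub> j \<in> I <+>\<^bsub>A\<^esub> J" if "i \<in> I" "j \<in> J" for i j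
    using that by (auto simp: set_add_def')
  show ?thesis
  proof (rule algebra_idealI)
    show "I <+>\<^bsub>A\<^esub> J \<subseteq> carrier A"
      using IJ(2,11) by (rule M.set_add_closed)
    show "\<zero>\<^bsub>A\<^esub> \<in> I <+>\<^bsub>A\<^esub> J"
      using mem[OF IJ(3) IJ(12)] by simp
  next
    fix x y assume "x \<in> I <+>\<^bsub>A\<^esub> J" "y \<in> I <+>\<^bsub>A\<^esub> J"
    then obtain i j i' j' where ij: "i \<in> I" "j \<in> J" "i' \<in> I" "j' \<in> J"
      and "x = i \<oplus>\<^bsub>A\<^esub> j" "y = i' \<oplus>\<^bsub>A\<^esub> j'"
      by (auto simp: set_add_def')
    then have "x \<oplus>\<^bsub>A\<^esub> y = (i \<oplus>\<^bsub>A\<^esub> i') \<oplus>\<^bsub>A\<^esub> (j \<oplus>\<^bsub>A\<^esub> j')"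
      using carr by (simp add: M.a_ac)
    then show "x \<oplus>\<^bsub>A\<^esub> y \<in> I <+>\<^bsub>A\<^esub> J"
      using mem IJ ij by simp
  next
    fix c x assume c: "c \<in> carrier K" and "x \<in> I <+>\<^bsub>A\<^esub> J"
    then obtain i j where ij: "i \<in> I" "j \<in> J" and "x = i \<oplus>\<^bsub>A\<^esub> j"
      by (auto simp: set_add_def')
    then have "c \<odot>\<^bsub>A\<^esub> x = c \<odot>\<^bsub>A\<^esub> i \<oplus>\<^bsub>A\<^esub> c \<odot>\<^bsub>A\<^esub> j"
      using c carr by (simp add: smult_r_distr)
    then show "c \<odot>\<^bsub>A\<^esub> x \<in> I <+>\<^bsub>A\<^esub> J"
      using mem IJ(7,16) c ij by simp
  next
    fix x r assume r: "r \<in> carrier A" and "x \<in> I <+>\<^bsub>A\<^esub> J"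
    then obtain i j where ij: "i \<in> I" "j \<in> J" and "x = i \<oplus>\<^bsub>A\<^esub> j"
      by (auto simp: set_add_def')
    then have "x \<otimes>\<^bsub>A\<^esub> r = i \<otimes>\<^bsub>A\<^esub> r \<oplus>\<^bsub>A\<^esub> j \<otimes>\<^bsub>A\<^esub> r"
      "r \<otimes>\<^bsub>A\<^esub> x = r \<otimes>\<^bsub>A\<^esub> i \<oplus>\<^bsub>A\<^esub> r \<otimes>\<^bsub>A\<^esub> j"
      using r carr by (simp_all add: mult_l_distr mult_r_distr)
    then show "x \<otimes>\<^bsub>A\<^esub> r \<in> I <+>\<^bsub>A\<^esub> J" "r \<otimes>\<^bsub>A\<^esub> x \<in> I <+>\<^bsub>A\<^esub> J"
      using mem IJ(8,9,17,18) r ij by simp_all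
  qed
qed

lemma ideal_sum_supset:
  assumes I: "algebra_ideal K A I" and J: "algebra_ideal K A J"
  shows "I \<subseteq> I <+>\<^bsub>A\<^esub> J" "J \<subseteq> I <+>\<^bsub>A\<^esub> J"
proof
  fix x assume x: "x \<in> I"
  then have "x = x \<oplus>\<^bsub>A\<^esub> \<zero>\<^bsub>A\<^esub>"
    using algebra_idealD(2)[OF I] by auto
  then show "x \<in> I <+>\<^bsub>A\<^esub> J"
    using x algebra_idealD(3)[OF J] by (auto simp: set_add_def')
next
  show "J \<subseteq> I <+>\<^bsub>A\<^esub> J"
  proof
    fix x assume x: "x \<in> J"
    then have "x = \<zero>\<^bsub>A\<^esub> \<oplus>\<^bsub>A\<^esub> x"
      using algebra_idealD(2)[OF J] by auto
    then show "x \<in> I <+>\<^bsub>A\<^esub> J"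
      using x algebra_idealD(3)[OF I] by (auto simp: set_add_def')
  qed
qed


subsection \<open>The von Neumann regular radical\<close>

text \<open>If \<open>x - x b x = c\<close> and \<open>c = c d c\<close>, then \<open>x = x b x + (x - x b x) d (x - x b x)\<close>
  has the form \<open>x \<dots> x\<close>.\<close>

lemma vN_regular_step:
  assumes x: "x \<in> carrier A" and b: "b \<in> carrier A" and d: "d \<in> carrier A"
    and c: "c = x \<ominus>\<^bsub>A\<^esub> (x \<otimes>\<^bsub>A\<^esub> b) \<otimes>\<^bsub>A\<^esub> x" "c = (c \<otimes>\<^bsub>A\<^esub> d) \<otimes>\<^bsub>A\<^esub> c"
  shows "\<exists>e\<in>carrier A. x = (x \<otimes>\<^bsub>A\<^esub> e) \<otimes>\<^bsub>A\<^esub> x"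
proof -
  let ?S = "{(x \<otimes>\<^bsub>A\<^esub> e) \<otimes>\<^bsub>A\<^esub> x | e. e \<in> carrier A}"
  have S: "subgroup ?S (add_monoid A)"
  proof (rule M.add_subgroupI)
    show "\<zero>\<^bsub>A\<^esub> \<in> ?S"
      using x by (auto simp: mult_l_zero mult_r_zero intro!: exI[of _ "\<zero>\<^bsub>A\<^esub>"])
  next
    fix u assume "u \<in> ?S"
    then obtain e where e: "e \<in> carrier A" "u = (x \<otimes>\<^bsub>A\<^esub> e) \<otimes>\<^bsub>A\<^esub> x" by blast
    then have "\<ominus>\<^bsub>A\<^esub> u = (x \<otimes>\<^bsub>A\<^esub> \<ominus>\<^bsub>A\<^esub> e) \<otimes>\<^bsub>A\<^esub> x"
      using x by (simp add: mult_l_minus mult_r_minus mult_closed)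
    then show "\<ominus>\<^bsub>A\<^esub> u \<in> ?S"
      using e by blast
  next
    fix u v assume "u \<in> ?S" "v \<in> ?S"
    then obtain e f where e: "e \<in> carrier A" "u = (x \<otimes>\<^bsub>A\<^esub> e) \<otimes>\<^bsub>A\<^esub> x"
      and f: "f \<in> carrier A" "v = (x \<otimes>\<^bsub>A\<^esub> f) \<otimes>\<^bsub>A\<^esub> x" by blast
    then have "u \<oplus>\<^bsub>A\<^esub> v = (x \<otimes>\<^bsub>A\<^esub> (e \<oplus>\<^bsub>A\<^esub> f)) \<otimes>\<^bsub>A\<^esub> x"
      using x by (simp add: mult_l_distr mult_r_distr mult_closed)
    then show "u \<oplus>\<^bsub>A\<^esub> v \<in> ?S"
      using e f by blast
  qed (use x in \<open>auto simp: mult_closed\<close>)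
  have mem: "(x \<otimes>\<^bsub>A\<^esub> e) \<otimes>\<^bsub>A\<^esub> x \<in> ?S" if "e \<in> carrier A" for e
    using that by blast
  let ?y = "(x \<otimes>\<^bsub>A\<^esub> b) \<otimes>\<^bsub>A\<^esub> x"
  have y: "?y \<in> carrier A"
    using x b by (simp add: mult_closed)
  have c_carr: "c \<in> carrier A"
    using x y c by simp
  \<comment> \<open>In a unital ring \<open>c = x (1 - b x) = (1 - x b) x\<close>. Without a unit
    these factors do not exist, so \<open>x\<close> is pulled out only after \<open>c\<close> has
    been multiplied by some \<open>e\<close>.\<close>
  have c_left: "c \<otimes>\<^bsub>A\<^esub> e = x \<otimes>\<^bsub>A\<^esub> (e \<ominus>\<^bsub>A\<^esub> b \<otimes>\<^bsub>A\<^esub> (x \<otimes>\<^bsub>A\<^esub> e))" if "e \<in> carrier A" for e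
    using that x b y
    by (simp add: c(1) a_minus_def mult_l_distr mult_r_distr mult_l_minus mult_r_minus
        mult_closed mult_assoc)
  have c_right: "e \<otimes>\<^bsub>A\<^esub> c = (e \<ominus>\<^bsub>A\<^esub> (e \<otimes>\<^bsub>A\<^esub> x) \<otimes>\<^bsub>A\<^esub> b) \<otimes>\<^bsub>A\<^esub> x" if "e \<in> carrier A" for e
    using that x b y
    by (simp add: c(1) a_minus_def mult_l_distr mult_r_distr mult_l_minus mult_r_minus
        mult_closed mult_assoc)
  \<comment> \<open>Chosen so that \<open>d c = e x\<close>; then
    \<open>c = c d c = (c e) x\<close>, and \<open>c_left\<close> extracts the other
    \<open>x\<close>.\<close>
  define e where "e = d \<ominus>\<^bsub>A\<^esub> (d \<otimes>\<^bsub>A\<^esub> x) \<otimes>\<^bsub>A\<^esub> b"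
  have e: "e \<in> carrier A"
    using x b d by (simp add: e_def mult_closed)
  have "c = c \<otimes>\<^bsub>A\<^esub> (d \<otimes>\<^bsub>A\<^esub> c)"
    using c(2) mult_assoc[OF c_carr d c_carr] by simp
  also have "\<dots> = (c \<otimes>\<^bsub>A\<^esub> e) \<otimes>\<^bsub>A\<^esub> x"
    using c_right[OF d] e x c_carr by (simp add: e_def[symmetric] mult_assoc)
  also have "\<dots> = (x \<otimes>\<^bsub>A\<^esub> (e \<ominus>\<^bsub>A\<^esub> b \<otimes>\<^bsub>A\<^esub> (x \<otimes>\<^bsub>A\<^esub> e))) \<otimes>\<^bsub>A\<^esub> x"
    using c_left[OF e] by simp
  also have "\<dots> \<in> ?S"
    using e x b by (intro mem) (simp add: mult_closed)
  finally have "c \<in> ?S" .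
  moreover have "x = c \<oplus>\<^bsub>A\<^esub> ?y"
    using x y by (simp add: c(1) a_minus_def M.a_assoc M.l_neg)
  ultimately have "x \<in> ?S"
    using M.subgroup_a_closed[OF S _ mem[OF b], of c] by simp
  then show ?thesis
    by blast
qed

text \<open>Modulo \<open>I\<close> the element \<open>x + y\<close> is the regular element
  \<open>y\<close>, so some \<open>a - a b a\<close> falls into \<open>I\<close>, is regular there,
  and \<open>vN_regular_step\<close> applies.\<close>

lemma vN_regular_ideal_sum:
  assumes I: "vN_regular_ideal K A I" and J: "vN_regular_ideal K A J"
  shows "vN_regular_ideal K A (I <+>\<^bsub>A\<^esub> J)"
  unfolding vN_regular_ideal_def
proof (intro conjI ballI)
  have II: "algebra_ideal K A I" and JJ: "algebra_ideal K A J"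
    using I J by (auto simp: vN_regular_ideal_def)
  then show "algebra_ideal K A (I <+>\<^bsub>A\<^esub> J)"
    by (rule algebra_ideal_sum)
  fix a assume "a \<in> I <+>\<^bsub>A\<^esub> J"
  then obtain x y where xy: "x \<in> I" "y \<in> J" "a = x \<oplus>\<^bsub>A\<^esub> y"
    by (auto simp: set_add_def')
  have carr: "x \<in> carrier A" "y \<in> carrier A"
    using xy algebra_idealD(2)[OF II] algebra_idealD(2)[OF JJ] by auto
  obtain b where b: "b \<in> carrier A" "y = (y \<otimes>\<^bsub>A\<^esub> b) \<otimes>\<^bsub>A\<^esub> y"
    using J xy(2) unfolding vN_regular_ideal_def by blast
  have prods: "y \<otimes>\<^bsub>A\<^esub> b \<in> carrier A" "x \<otimes>\<^bsub>A\<^esub> b \<in> I"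
    using xy carr b algebra_idealD[OF II] by (auto simp: mult_closed)
  \<comment> \<open>These are the terms of \<open>a b a\<close> with a factor \<open>x\<close>. The
    remaining term is \<open>y b y = y\<close>, so \<open>a b a = z + y\<close> and
    \<open>a - a b a = x - z\<close>.\<close>
  let ?z = "(x \<otimes>\<^bsub>A\<^esub> b) \<otimes>\<^bsub>A\<^esub> a \<oplus>\<^bsub>A\<^esub> (y \<otimes>\<^bsub>A\<^esub> b) \<otimes>\<^bsub>A\<^esub> x"
  have z: "?z \<in> I"
    using algebra_idealD[OF II] xy carr b(1) prods by simp
  have xb: "x \<otimes>\<^bsub>A\<^esub> b \<in> carrier A" and zc: "?z \<in> carrier A"
    using z prods algebra_idealD(2)[OF II] by auto
  have "(a \<otimes>\<^bsub>A\<^esub> b) \<otimes>\<^bsub>A\<^esub> a = (x \<otimes>\<^bsub>A\<^esub> b) \<otimes>\<^bsub>A\<^esub> a \<oplus>\<^bsub>A\<^esub> (y \<otimes>\<^bsub>A\<^esub> b) \<otimes>\<^bsub>A\<^esub> a"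
    using xy(3) carr b(1) xb prods by (simp add: mult_l_distr)
  also have "(y \<otimes>\<^bsub>A\<^esub> b) \<otimes>\<^bsub>A\<^esub> a = (y \<otimes>\<^bsub>A\<^esub> b) \<otimes>\<^bsub>A\<^esub> x \<oplus>\<^bsub>A\<^esub> y"
    using xy(3) carr prods b(2) by (simp add: mult_r_distr)
  finally have "(a \<otimes>\<^bsub>A\<^esub> b) \<otimes>\<^bsub>A\<^esub> a = ?z \<oplus>\<^bsub>A\<^esub> y"
    using xy(3) carr xb prods by (simp add: M.a_assoc mult_closed)
  then have "a \<ominus>\<^bsub>A\<^esub> (a \<otimes>\<^bsub>A\<^esub> b) \<otimes>\<^bsub>A\<^esub> a = x \<ominus>\<^bsub>A\<^esub> ?z"
    using xy(3) carr zc by (simp add: a_minus_def M.minus_add M.a_ac M.r_neg M.r_neg1 M.r_neg2)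
  then have c: "a \<ominus>\<^bsub>A\<^esub> (a \<otimes>\<^bsub>A\<^esub> b) \<otimes>\<^bsub>A\<^esub> a \<in> I"
    using z xy(1) algebra_idealD(6)[OF II] by simp
  then obtain d where "d \<in> carrier A"
    "a \<ominus>\<^bsub>A\<^esub> (a \<otimes>\<^bsub>A\<^esub> b) \<otimes>\<^bsub>A\<^esub> a =
      ((a \<ominus>\<^bsub>A\<^esub> (a \<otimes>\<^bsub>A\<^esub> b) \<otimes>\<^bsub>A\<^esub> a) \<otimes>\<^bsub>A\<^esub> d) \<otimes>\<^bsub>A\<^esub> (a \<ominus>\<^bsub>A\<^esub> (a \<otimes>\<^bsub>A\<^esub> b) \<otimes>\<^bsub>A\<^esub> a)"
    using I unfolding vN_regular_ideal_def by blast
  then show "\<exists>e\<in>carrier A. a = (a \<otimes>\<^bsub>A\<^esub> e) \<otimes>\<^bsub>A\<^esub> a"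
    using vN_regular_step[of a b d] xy(3) carr b(1) by simp
qed

text \<open>\<open>GREATEST\<close> is meaningful only once a greatest member is exhibited. It is
  the union of all regular ideals: the zero ideal makes the family non-empty, sums make it directed,
  and regularity is checked element by element.\<close>

lemma vN_regular_ideal_r_n: "vN_regular_ideal K A (r_n K A)"
proof -
  let ?\<I> = "{I. vN_regular_ideal K A I}"
  have zero: "{\<zero>\<^bsub>A\<^esub>} \<in> ?\<I>"
    by (auto simp: vN_regular_ideal_def algebra_ideal_zero mult_l_zero mult_r_zero
        intro!: bexI[of _ "\<zero>\<^bsub>A\<^esub>"])
  have "algebra_ideal K A (\<Union>?\<I>)"
  proof (rule algebra_ideal_Union_directed)
    fix I J assume "I \<in> ?\<I>" "J \<in> ?\<I>"
    then show "\<exists>L\<in>?\<I>. I \<subseteq> L \<and> J \<subseteq> L"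
      using vN_regular_ideal_sum[of I J] ideal_sum_supset[of I J]
      by (intro bexI[of _ "I <+>\<^bsub>A\<^esub> J"]) (auto simp: vN_regular_ideal_def)
  qed (use zero in \<open>auto simp: vN_regular_ideal_def\<close>)
  then have "vN_regular_ideal K A (\<Union>?\<I>)"
    by (auto simp: vN_regular_ideal_def)
  then show ?thesis
    unfolding r_n_def by (rule GreatestI2_order) auto
qed

end


subsection \<open>\<open>H\<close>-ideals\<close>

definition sandwich ::
    "('k, 'h, 'b) module_scheme \<Rightarrow> ('k, 'h, 'r, 'c) hmodule_scheme \<Rightarrow> 'r \<Rightarrow> 'r set"
  where "sandwich H R a =
    {((g \<rightharpoonup>\<^bsub>R\<^esub> a) \<otimes>\<^bsub>R\<^esub> b) \<otimes>\<^bsub>R\<^esub> (g' \<rightharpoonup>\<^bsub>R\<^esub> a) | g g' b.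
      g \<in> carrier H \<and> g' \<in> carrier H \<and> b \<in> carrier R}"

text \<open>The additive group \<open>(H \<cdot> a) R (H \<cdot> a)\<close>.\<close>

definition sandwich_span ::
    "('k, 'h, 'b) module_scheme \<Rightarrow> ('k, 'h, 'r, 'c) hmodule_scheme \<Rightarrow> 'r \<Rightarrow> 'r set"
  where "sandwich_span H R a = generate (add_monoid R) (sandwich H R a)"

text \<open>Stated for a bare abelian group so that it applies to the record
  \<open>H_quotient R N\<close>, which enters the proof only as an abelian group with a projection
  onto it.\<close>

lemma H_regular_element_imp_span:
  assumes "abelian_group R" "sandwich H R a \<subseteq> carrier R" "H_regular_element H R a"
  shows "a \<in> sandwich_span H R a"
proof -
  interpret R: abelian_group R by fact
  obtain n :: nat and g g' b where
    "\<forall>i<n. g i \<in> carrier H \<and> g' i \<in> carrier H \<and> b i \<in> carrier R"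
    and a: "a = (\<Oplus>\<^bsub>R\<^esub>i\<in>{..<n}. ((g i \<rightharpoonup>\<^bsub>R\<^esub> a) \<otimes>\<^bsub>R\<^esub> b i) \<otimes>\<^bsub>R\<^esub> (g' i \<rightharpoonup>\<^bsub>R\<^esub> a))"
    using assms(3) unfolding H_regular_element_def by blast
  then have "((g i \<rightharpoonup>\<^bsub>R\<^esub> a) \<otimes>\<^bsub>R\<^esub> b i) \<otimes>\<^bsub>R\<^esub> (g' i \<rightharpoonup>\<^bsub>R\<^esub> a) \<in> sandwich_span H R a"
    if "i \<in> {..<n}" for i
    using that unfolding sandwich_span_def sandwich_def by (intro generate.incl) blast
  moreover have "subgroup (sandwich_span H R a) (add_monoid R)"
    unfolding sandwich_span_def
    by (rule group.generate_is_subgroup[OF R.a_group]) (simp add: assms(2))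
  ultimately have "(\<Oplus>\<^bsub>R\<^esub>i\<in>{..<n}. ((g i \<rightharpoonup>\<^bsub>R\<^esub> a) \<otimes>\<^bsub>R\<^esub> b i) \<otimes>\<^bsub>R\<^esub> (g' i \<rightharpoonup>\<^bsub>R\<^esub> a))
      \<in> sandwich_span H R a"
    by (intro R.finsum_in_subgroup)
  then show ?thesis
    by (simp flip: a)
qed

context H_module_algebra
begin

lemma algebra_ideal_of_H_ideal: "H_ideal K H R I \<Longrightarrow> algebra_ideal K R I"
  by (simp add: H_ideal_def)

lemma H_ideal_hact: "\<lbrakk>H_ideal K H R I; h \<in> carrier H; x \<in> I\<rbrakk> \<Longrightarrow> h \<rightharpoonup>\<^bsub>R\<^esub> x \<in> I"
  by (simp add: H_ideal_def)

lemma H_ideal_in_carrier: "\<lbrakk>H_ideal K H R I; x \<in> I\<rbrakk> \<Longrightarrow> x \<in> carrier R"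
  using R.algebra_idealD(2) algebra_ideal_of_H_ideal by blast

lemma hact_hom:
  "h \<in> carrier H \<Longrightarrow> (\<lambda>x. h \<rightharpoonup>\<^bsub>R\<^esub> x) \<in> hom (add_monoid R) (add_monoid R)"
  by (rule homI) (auto simp: hact_closed hact_r_distr)

lemma hact_zero: "h \<in> carrier H \<Longrightarrow> h \<rightharpoonup>\<^bsub>R\<^esub> \<zero>\<^bsub>R\<^esub> = \<zero>\<^bsub>R\<^esub>"
  using hact_r_distr[of h "\<zero>\<^bsub>R\<^esub>" "\<zero>\<^bsub>R\<^esub>"] hact_closed[of h "\<zero>\<^bsub>R\<^esub>"]
  by (simp add: R.M.add.l_cancel_one)

text \<open>A scalar \<open>c\<close> acts as the element \<open>c\<close> times \<open>1\<close> of
  \<open>H\<close>, and this element commutes with \<open>h\<close>.\<close>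

lemma hact_smult_right:
  assumes "h \<in> carrier H" "c \<in> carrier K" "x \<in> carrier R"
  shows "h \<rightharpoonup>\<^bsub>R\<^esub> (c \<odot>\<^bsub>R\<^esub> x) = c \<odot>\<^bsub>R\<^esub> (h \<rightharpoonup>\<^bsub>R\<^esub> x)"
proof -
  have "c \<odot>\<^bsub>R\<^esub> x = (c \<odot>\<^bsub>H\<^esub> \<one>\<^bsub>H\<^esub>) \<rightharpoonup>\<^bsub>R\<^esub> x"
    using assms by (simp add: hact_smult hact_one)
  then have "h \<rightharpoonup>\<^bsub>R\<^esub> (c \<odot>\<^bsub>R\<^esub> x) = (h \<otimes>\<^bsub>H\<^esub> (c \<odot>\<^bsub>H\<^esub> \<one>\<^bsub>H\<^esub>)) \<rightharpoonup>\<^bsub>R\<^esub> x"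
    using assms by (simp add: hact_mult)
  also have "\<dots> = (c \<odot>\<^bsub>H\<^esub> h) \<rightharpoonup>\<^bsub>R\<^esub> x"
    using assms H.smult_mult_right[of c h "\<one>\<^bsub>H\<^esub>"] by simp
  finally show ?thesis
    using assms by (simp add: hact_smult)
qed

text \<open>The only gateway from \<open>\<Delta>\<close> to the rest of the proof. Linearity of the
  action and bilinearity of the product make the Sweedler summand biadditive and balanced, so
  \<open>tensor_lift_in_subgroup\<close> applies to \<open>\<Delta> h\<close>.\<close>

lemma hact_prod_in_subgroup:
  assumes h: "h \<in> carrier H" and xy: "x \<in> carrier R" "y \<in> carrier R"
    and A: "subgroup A (add_monoid R)"
    and mem: "\<And>h1 h2. \<lbrakk>h1 \<in> carrier H; h2 \<in> carrier H\<rbrakk>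
      \<Longrightarrow> (h1 \<rightharpoonup>\<^bsub>R\<^esub> x) \<otimes>\<^bsub>R\<^esub> (h2 \<rightharpoonup>\<^bsub>R\<^esub> y) \<in> A"
  shows "h \<rightharpoonup>\<^bsub>R\<^esub> (x \<otimes>\<^bsub>R\<^esub> y) \<in> A"
proof -
  have "\<Delta> h \<in> carrier (tensor K H H)"
    using comult_linear h by (auto simp: linear_map_def)
  then show ?thesis
    unfolding hact_prod[OF h xy]
    by (rule H.tensor_lift_in_subgroup[OF R.M.abelian_group_axioms H.module_axioms A])
      (use xy mem in \<open>auto simp: hact_l_distr hact_smult hact_closed R.mult_l_distr
        R.mult_r_distr R.smult_mult_left R.smult_mult_right\<close>)
qed

lemma H_ideal_zero: "H_ideal K H R {\<zero>\<^bsub>R\<^esub>}"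
  by (simp add: H_ideal_def R.algebra_ideal_zero hact_zero)

lemma H_ideal_sum:
  assumes "H_ideal K H R I" "H_ideal K H R J"
  shows "H_ideal K H R (I <+>\<^bsub>R\<^esub> J)"
  unfolding H_ideal_def
proof (intro conjI ballI)
  show "algebra_ideal K R (I <+>\<^bsub>R\<^esub> J)"
    using assms by (intro R.algebra_ideal_sum algebra_ideal_of_H_ideal)
  fix h x assume h: "h \<in> carrier H" and "x \<in> I <+>\<^bsub>R\<^esub> J"
  then obtain i j where ij: "i \<in> I" "j \<in> J" and "x = i \<oplus>\<^bsub>R\<^esub> j"
    by (auto simp: set_add_def')
  then have "h \<rightharpoonup>\<^bsub>R\<^esub> x = (h \<rightharpoonup>\<^bsub>R\<^esub> i) \<oplus>\<^bsub>R\<^esub> (h \<rightharpoonup>\<^bsub>R\<^esub> j)"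
    using h H_ideal_in_carrier[OF assms(1)] H_ideal_in_carrier[OF assms(2)]
    by (simp add: hact_r_distr)
  then show "h \<rightharpoonup>\<^bsub>R\<^esub> x \<in> I <+>\<^bsub>R\<^esub> J"
    using H_ideal_hact[OF assms(1) h ij(1)] H_ideal_hact[OF assms(2) h ij(2)]
    by (auto simp: set_add_def')
qed

lemma H_ideal_gen_is_H_ideal:
  assumes "a \<in> carrier R"
  shows "H_ideal K H R (H_ideal_gen K H R a)"
proof -
  \<comment> \<open>A member of the family to be intersected; an empty intersection would be the
    whole type.\<close>
  have "H_ideal K H R (carrier R)"
    by (simp add: H_ideal_def R.algebra_ideal_carrier hact_closed)
  then have "algebra_ideal K R (H_ideal_gen K H R a)"
    unfolding H_ideal_gen_def using assms
    by (intro R.algebra_ideal_Inter) (blast, simp add: H_ideal_def)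
  then show ?thesis
    by (auto simp: H_ideal_def H_ideal_gen_def)
qed

text \<open>For pulling an ideal of a quotient back to \<open>R\<close>; that is why
  \<open>S\<close> is merely an abelian group.\<close>

lemma H_ideal_vimage:
  assumes S: "abelian_group S" and f: "H_hom K H R S f" and J: "H_ideal K H S J"
  shows "H_ideal K H R {x \<in> carrier R. f x \<in> J}"
proof -
  interpret S: abelian_group S by fact
  have hom: "f \<in> carrier R \<rightarrow> carrier S"
    "\<And>x y. \<lbrakk>x \<in> carrier R; y \<in> carrier R\<rbrakk> \<Longrightarrow> f (x \<oplus>\<^bsub>R\<^esub> y) = f x \<oplus>\<^bsub>S\<^esub> f y"
    "\<And>x y. \<lbrakk>x \<in> carrier R; y \<in> carrier R\<rbrakk> \<Longrightarrow> f (x \<otimes>\<^bsub>R\<^esub> y) = f x \<otimes>\<^bsub>S\<^esub> f y"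
    "\<And>c x. \<lbrakk>c \<in> carrier K; x \<in> carrier R\<rbrakk> \<Longrightarrow> f (c \<odot>\<^bsub>R\<^esub> x) = c \<odot>\<^bsub>S\<^esub> f x"
    "\<And>h x. \<lbrakk>h \<in> carrier H; x \<in> carrier R\<rbrakk> \<Longrightarrow> f (h \<rightharpoonup>\<^bsub>R\<^esub> x) = h \<rightharpoonup>\<^bsub>S\<^esub> f x"
    using f by (auto simp: H_hom_def linear_map_def)
  have f_closed: "f x \<in> carrier S" if "x \<in> carrier R" for x
    using that hom(1) by blast
  have sub: "submodule J K S"
    and J_ideal: "\<And>x r. \<lbrakk>x \<in> J; r \<in> carrier S\<rbrakk> \<Longrightarrow> x \<otimes>\<^bsub>S\<^esub> r \<in> J \<and> r \<otimes>\<^bsub>S\<^esub> x \<in> J"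
    and J_hact: "\<And>h x. \<lbrakk>h \<in> carrier H; x \<in> J\<rbrakk> \<Longrightarrow> h \<rightharpoonup>\<^bsub>S\<^esub> x \<in> J"
    using J by (auto simp: H_ideal_def algebra_ideal_def)
  note J_group = submodule.axioms(1)[OF sub]
  have "f \<zero>\<^bsub>R\<^esub> = \<zero>\<^bsub>S\<^esub>"
    using hom(2)[of "\<zero>\<^bsub>R\<^esub>" "\<zero>\<^bsub>R\<^esub>"] funcset_mem[OF hom(1), of "\<zero>\<^bsub>R\<^esub>"]
    by (simp add: S.add.l_cancel_one')
  have "algebra_ideal K R {x \<in> carrier R. f x \<in> J}"
  proof (rule R.algebra_idealI)
    show "\<zero>\<^bsub>R\<^esub> \<in> {x \<in> carrier R. f x \<in> J}"
      using S.subgroup_zero_closed[OF J_group] by (simp add: \<open>f \<zero>\<^bsub>R\<^esub> = \<zero>\<^bsub>S\<^esub>\<close>)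
  qed (use S.subgroup_a_closed[OF J_group] J_ideal submodule.smult_closed[OF sub]
    in \<open>auto simp: hom(2-4) f_closed R.mult_closed\<close>)
  then show ?thesis
    using J_hact by (simp add: H_ideal_def hact_closed hom(5))
qed


subsection \<open>Additive spans of sandwich products\<close>

lemma sandwich_subset: "a \<in> carrier R \<Longrightarrow> sandwich H R a \<subseteq> carrier R"
  by (auto simp: sandwich_def R.mult_closed hact_closed)

lemma sandwich_span_subgroup:
  "a \<in> carrier R \<Longrightarrow> subgroup (sandwich_span H R a) (add_monoid R)"
  unfolding sandwich_span_def
  by (rule group.generate_is_subgroup[OF R.M.a_group]) (simp add: sandwich_subset)

text \<open>An induction principle for \<open>T(a)\<close>: an additive map lands in
  \<open>A\<close> as soon as it does so on single sandwich products. It is applied to the action of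
  \<open>h\<close> and to multiplications on either side.\<close>

lemma sandwich_span_hom:
  assumes "f \<in> hom (add_monoid R) (add_monoid R)" "a \<in> carrier R"
    and "subgroup A (add_monoid R)"
    and "\<And>g g' b. \<lbrakk>g \<in> carrier H; g' \<in> carrier H; b \<in> carrier R\<rbrakk>
      \<Longrightarrow> f (((g \<rightharpoonup>\<^bsub>R\<^esub> a) \<otimes>\<^bsub>R\<^esub> b) \<otimes>\<^bsub>R\<^esub> (g' \<rightharpoonup>\<^bsub>R\<^esub> a)) \<in> A"
    and "t \<in> sandwich_span H R a"
  shows "f t \<in> A"
proof -
  have "f ` sandwich_span H R a \<subseteq> A"
    unfolding sandwich_span_def using assms
    by (intro hom_generate_subset[OF R.M.a_group R.M.a_group])
      (use sandwich_subset in \<open>auto simp: sandwich_def\<close>)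
  then show ?thesis
    using assms(5) by blast
qed

text \<open>Links the indexed finite sums of the definition with the generated subgroup. From right
  to left, inverses must be absorbed and sums put into the form indexed by
  \<open>{..<n}\<close>.\<close>

lemma H_regular_element_iff_span:
  assumes a: "a \<in> carrier R"
  shows "H_regular_element H R a \<longleftrightarrow> a \<in> sandwich_span H R a"
proof
  assume "H_regular_element H R a"
  then show "a \<in> sandwich_span H R a"
    using H_regular_element_imp_span[OF R.M.abelian_group_axioms sandwich_subset[OF a]] by simp
next
  let ?term = "\<lambda>g g' b. ((g \<rightharpoonup>\<^bsub>R\<^esub> a) \<otimes>\<^bsub>R\<^esub> b) \<otimes>\<^bsub>R\<^esub> (g' \<rightharpoonup>\<^bsub>R\<^esub> a)"
  define F where "F = {y. \<exists>n::nat. \<exists>g g' b.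
    (\<forall>i<n. g i \<in> carrier H \<and> g' i \<in> carrier H \<and> b i \<in> carrier R) \<and>
    y = (\<Oplus>\<^bsub>R\<^esub>i\<in>{..<n}. ?term (g i) (g' i) (b i))}"
  have term_closed: "?term g g' b \<in> carrier R"
    if "g \<in> carrier H" "g' \<in> carrier H" "b \<in> carrier R" for g g' b
    using that a by (simp add: R.mult_closed hact_closed)
  have F_zero: "\<zero>\<^bsub>R\<^esub> \<in> F"
    unfolding F_def by (auto intro!: exI[of _ "0::nat"])
  have F_closed: "y \<in> carrier R" if "y \<in> F" for y
    using that unfolding F_def by (auto intro!: R.M.finsum_closed term_closed)
  have F_step: "?term g g' b \<oplus>\<^bsub>R\<^esub> y \<in> F"
    if g: "g \<in> carrier H" "g' \<in> carrier H" "b \<in> carrier R" and "y \<in> F" for g g' b y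
  proof -
    obtain n :: nat and gs gs' bs where
      gs: "\<forall>i<n. gs i \<in> carrier H \<and> gs' i \<in> carrier H \<and> bs i \<in> carrier R"
      and y: "y = (\<Oplus>\<^bsub>R\<^esub>i\<in>{..<n}. ?term (gs i) (gs' i) (bs i))"
      using \<open>y \<in> F\<close> unfolding F_def by blast
    \<comment> \<open>The new term is stored at index \<open>n\<close>, which leaves the families
      unchanged below \<open>n\<close>.\<close>
    let ?t = "\<lambda>i. ?term ((gs(n := g)) i) ((gs'(n := g')) i) ((bs(n := b)) i)"
    have "(\<Oplus>\<^bsub>R\<^esub>i\<in>{..<Suc n}. ?t i) = ?t n \<oplus>\<^bsub>R\<^esub> (\<Oplus>\<^bsub>R\<^esub>i\<in>{..<n}. ?t i)"
      unfolding lessThan_Suc using gs g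
      by (intro R.M.finsum_insert) (auto intro!: term_closed)
    also have "(\<Oplus>\<^bsub>R\<^esub>i\<in>{..<n}. ?t i) = y"
      unfolding y using gs by (intro R.M.finsum_cong') (auto intro!: term_closed)
    finally have "?term g g' b \<oplus>\<^bsub>R\<^esub> y = (\<Oplus>\<^bsub>R\<^esub>i\<in>{..<Suc n}. ?t i)"
      by simp
    moreover have "\<forall>i<Suc n. (gs(n := g)) i \<in> carrier H \<and> (gs'(n := g')) i \<in> carrier H \<and>
        (bs(n := b)) i \<in> carrier R"
      using gs g by (auto simp: less_Suc_eq)
    ultimately show ?thesis
      unfolding F_def by blast
  qed
  \<comment> \<open>Closure of \<open>F\<close> under addition would require concatenating index
    families. The elements whose translations in both directions preserve \<open>F\<close> form a
    subgroup for formal reasons, and a generator belongs to it by adding one term at a time; finally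
    \<open>a + 0\<close> is in \<open>F\<close>.\<close>
  define T where "T = {x \<in> carrier R. \<forall>y\<in>F. x \<oplus>\<^bsub>R\<^esub> y \<in> F \<and> \<ominus>\<^bsub>R\<^esub> x \<oplus>\<^bsub>R\<^esub> y \<in> F}"
  have T: "subgroup T (add_monoid R)"
  proof (rule R.M.add_subgroupI)
    fix x y assume xy: "x \<in> T" "y \<in> T"
    then have "x \<oplus>\<^bsub>R\<^esub> y \<oplus>\<^bsub>R\<^esub> z = x \<oplus>\<^bsub>R\<^esub> (y \<oplus>\<^bsub>R\<^esub> z)"
      "\<ominus>\<^bsub>R\<^esub> (x \<oplus>\<^bsub>R\<^esub> y) \<oplus>\<^bsub>R\<^esub> z = \<ominus>\<^bsub>R\<^esub> x \<oplus>\<^bsub>R\<^esub> (\<ominus>\<^bsub>R\<^esub> y \<oplus>\<^bsub>R\<^esub> z)" if "z \<in> F" for z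
      using F_closed[OF that] by (auto simp: T_def R.M.a_assoc R.M.minus_add)
    then show "x \<oplus>\<^bsub>R\<^esub> y \<in> T"
      using xy by (auto simp: T_def)
  next
    have minus_zero: "\<ominus>\<^bsub>R\<^esub> \<zero>\<^bsub>R\<^esub> = \<zero>\<^bsub>R\<^esub>"
      using R.M.minus_equality[of "\<zero>\<^bsub>R\<^esub>" "\<zero>\<^bsub>R\<^esub>"] by simp
    show "\<zero>\<^bsub>R\<^esub> \<in> T"
      by (simp add: T_def F_closed minus_zero)
  qed (auto simp: T_def F_closed)
  have "sandwich H R a \<subseteq> T"
  proof
    fix x assume "x \<in> sandwich H R a"
    then obtain g g' b where g: "g \<in> carrier H" "g' \<in> carrier H" "b \<in> carrier R"
      and x: "x = ?term g g' b"
      by (auto simp: sandwich_def)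
    \<comment> \<open>The sign is moved into the middle factor, so a negated generator is again a
      generator.\<close>
    have "\<ominus>\<^bsub>R\<^esub> x = ?term g g' (\<ominus>\<^bsub>R\<^esub> b)"
      using g a by (simp add: x R.mult_l_minus R.mult_r_minus hact_closed R.mult_closed)
    then show "x \<in> T"
      using g x F_step term_closed by (auto simp: T_def)
  qed
  then have "sandwich_span H R a \<subseteq> T"
    unfolding sandwich_span_def by (rule group.generate_subgroup_incl[OF R.M.a_group _ T])
  moreover assume "a \<in> sandwich_span H R a"
  ultimately have "a \<oplus>\<^bsub>R\<^esub> \<zero>\<^bsub>R\<^esub> \<in> F"
    using F_zero unfolding T_def by blast
  then show "H_regular_element H R a"
    using a unfolding F_def H_regular_element_def by simp
qed

lemma sandwich_span_hact:
  assumes a: "a \<in> carrier R" and h: "h \<in> carrier H" and t: "t \<in> sandwich_span H R a"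
  shows "h \<rightharpoonup>\<^bsub>R\<^esub> t \<in> sandwich_span H R a"
proof (rule sandwich_span_hom[OF hact_hom[OF h] a sandwich_span_subgroup[OF a] _ t])
  fix g g' b assume g: "g \<in> carrier H" "g' \<in> carrier H" "b \<in> carrier R"
  note span = sandwich_span_subgroup[OF a]
  show "h \<rightharpoonup>\<^bsub>R\<^esub> (((g \<rightharpoonup>\<^bsub>R\<^esub> a) \<otimes>\<^bsub>R\<^esub> b) \<otimes>\<^bsub>R\<^esub> (g' \<rightharpoonup>\<^bsub>R\<^esub> a)) \<in> sandwich_span H R a"
  proof (rule hact_prod_in_subgroup[OF h _ _ span])
    fix h1 h2 assume h12: "h1 \<in> carrier H" "h2 \<in> carrier H"
    let ?z = "h2 \<rightharpoonup>\<^bsub>R\<^esub> (g' \<rightharpoonup>\<^bsub>R\<^esub> a)"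
    have z: "?z \<in> carrier R"
      using h12 g a by (simp add: hact_closed)
    \<comment> \<open>The product rule is needed twice, once for each multiplication in a sandwich.
      In the inner use the right factor \<open>z\<close> is fixed, so the target is the subgroup of
      all \<open>x\<close> that \<open>z\<close> multiplies into \<open>T(a)\<close>.\<close>
    let ?B = "{x \<in> carrier R. x \<otimes>\<^bsub>R\<^esub> ?z \<in> sandwich_span H R a}"
    have "h1 \<rightharpoonup>\<^bsub>R\<^esub> ((g \<rightharpoonup>\<^bsub>R\<^esub> a) \<otimes>\<^bsub>R\<^esub> b) \<in> ?B"
    proof (rule hact_prod_in_subgroup[OF h12(1)])
      show "subgroup ?B (add_monoid R)"
        using z R.M.subgroup_zero_closed[OF span] R.M.subgroup_a_inv_closed[OF span]
          R.M.subgroup_a_closed[OF span]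
        by (intro R.M.add_subgroupI) (auto simp: R.mult_l_zero R.mult_l_minus R.mult_l_distr)
    next
      fix k1 k2 assume k: "k1 \<in> carrier H" "k2 \<in> carrier H"
      \<comment> \<open>The outer factors stay in \<open>H . a\<close> because
        \<open>k1 . (g . a) = (k1 g) . a\<close>; the middle factor \<open>k2 . b\<close> is again
        an element of \<open>R\<close>.\<close>
      have "((k1 \<rightharpoonup>\<^bsub>R\<^esub> (g \<rightharpoonup>\<^bsub>R\<^esub> a)) \<otimes>\<^bsub>R\<^esub> (k2 \<rightharpoonup>\<^bsub>R\<^esub> b)) \<otimes>\<^bsub>R\<^esub> ?z =
          (((k1 \<otimes>\<^bsub>H\<^esub> g) \<rightharpoonup>\<^bsub>R\<^esub> a) \<otimes>\<^bsub>R\<^esub> (k2 \<rightharpoonup>\<^bsub>R\<^esub> b)) \<otimes>\<^bsub>R\<^esub> ((h2 \<otimes>\<^bsub>H\<^esub> g') \<rightharpoonup>\<^bsub>R\<^esub> a)"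
        using k h12 g a by (simp add: hact_mult)
      also have "\<dots> \<in> sandwich H R a"
        using k h12 g unfolding sandwich_def by (blast intro: H.mult_closed hact_closed)
      finally show "(k1 \<rightharpoonup>\<^bsub>R\<^esub> (g \<rightharpoonup>\<^bsub>R\<^esub> a)) \<otimes>\<^bsub>R\<^esub> (k2 \<rightharpoonup>\<^bsub>R\<^esub> b) \<in> ?B"
        using k g a unfolding sandwich_span_def
        by (auto intro: generate.incl simp: R.mult_closed hact_closed)
    qed (use g a in \<open>auto simp: hact_closed\<close>)
    then show "(h1 \<rightharpoonup>\<^bsub>R\<^esub> ((g \<rightharpoonup>\<^bsub>R\<^esub> a) \<otimes>\<^bsub>R\<^esub> b)) \<otimes>\<^bsub>R\<^esub> ?z \<in> sandwich_span H R a"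
      by simp
  qed (use g a in \<open>auto simp: hact_closed R.mult_closed\<close>)
qed

lemma sandwich_span_add:
  assumes a: "a \<in> carrier R" and t: "t \<in> sandwich_span H R a"
  shows "sandwich_span H R (a \<oplus>\<^bsub>R\<^esub> t) \<subseteq> sandwich_span H R a"
proof -
  let ?T = "sandwich_span H R a"
  note span = sandwich_span_subgroup[OF a]
  have T_closed: "u \<in> carrier R" if "u \<in> ?T" for u
    using that R.M.subgroup_in_carrier[OF span] by simp
  have memI: "((g \<rightharpoonup>\<^bsub>R\<^esub> a) \<otimes>\<^bsub>R\<^esub> b) \<otimes>\<^bsub>R\<^esub> (g' \<rightharpoonup>\<^bsub>R\<^esub> a) \<in> ?T"
    if "g \<in> carrier H" "g' \<in> carrier H" "b \<in> carrier R" for g g' b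
    using that unfolding sandwich_span_def sandwich_def by (intro generate.incl) blast
  \<comment> \<open>A generator of \<open>T(a)\<close> begins with a factor from
    \<open>H . a\<close>; everything between it and the last factor \<open>g . a\<close> is a new
    middle element.\<close>
  have left: "(u \<otimes>\<^bsub>R\<^esub> b) \<otimes>\<^bsub>R\<^esub> (g \<rightharpoonup>\<^bsub>R\<^esub> a) \<in> ?T"
    if "u \<in> ?T" "b \<in> carrier R" "g \<in> carrier H" for u b g
  proof (rule sandwich_span_hom[OF _ a span _ that(1)])
    have ga: "g \<rightharpoonup>\<^bsub>R\<^esub> a \<in> carrier R"
      using that a by (simp add: hact_closed)
    then show "(\<lambda>u. (u \<otimes>\<^bsub>R\<^esub> b) \<otimes>\<^bsub>R\<^esub> (g \<rightharpoonup>\<^bsub>R\<^esub> a)) \<in> hom (add_monoid R) (add_monoid R)"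
      using that by (intro homI) (auto simp: R.mult_closed R.mult_l_distr)
    fix k k' b' assume k: "k \<in> carrier H" "k' \<in> carrier H" "b' \<in> carrier R"
    then have "((((k \<rightharpoonup>\<^bsub>R\<^esub> a) \<otimes>\<^bsub>R\<^esub> b') \<otimes>\<^bsub>R\<^esub> (k' \<rightharpoonup>\<^bsub>R\<^esub> a)) \<otimes>\<^bsub>R\<^esub> b) \<otimes>\<^bsub>R\<^esub> (g \<rightharpoonup>\<^bsub>R\<^esub> a) =
        ((k \<rightharpoonup>\<^bsub>R\<^esub> a) \<otimes>\<^bsub>R\<^esub> (b' \<otimes>\<^bsub>R\<^esub> ((k' \<rightharpoonup>\<^bsub>R\<^esub> a) \<otimes>\<^bsub>R\<^esub> b))) \<otimes>\<^bsub>R\<^esub> (g \<rightharpoonup>\<^bsub>R\<^esub> a)"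
      using a ga that by (simp add: R.mult_assoc R.mult_closed hact_closed)
    then show "((((k \<rightharpoonup>\<^bsub>R\<^esub> a) \<otimes>\<^bsub>R\<^esub> b') \<otimes>\<^bsub>R\<^esub> (k' \<rightharpoonup>\<^bsub>R\<^esub> a)) \<otimes>\<^bsub>R\<^esub> b) \<otimes>\<^bsub>R\<^esub> (g \<rightharpoonup>\<^bsub>R\<^esub> a) \<in> ?T"
      using k a that by (simp add: memI R.mult_closed hact_closed)
  qed
  \<comment> \<open>The left factor is abstract because the lemma is used for
    \<open>x = g . c\<close>, about which only this is known: products \<open>x b (g' . a)\<close>
    lie in \<open>T(a)\<close>.\<close>
  have right: "(x \<otimes>\<^bsub>R\<^esub> b) \<otimes>\<^bsub>R\<^esub> u \<in> ?T"
    if "u \<in> ?T" and b: "b \<in> carrier R" and x: "x \<in> carrier R"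
      and xa: "\<And>b g. \<lbrakk>b \<in> carrier R; g \<in> carrier H\<rbrakk> \<Longrightarrow> (x \<otimes>\<^bsub>R\<^esub> b) \<otimes>\<^bsub>R\<^esub> (g \<rightharpoonup>\<^bsub>R\<^esub> a) \<in> ?T"
    for u b x
  proof (rule sandwich_span_hom[OF _ a span _ that(1)])
    show "(\<lambda>u. (x \<otimes>\<^bsub>R\<^esub> b) \<otimes>\<^bsub>R\<^esub> u) \<in> hom (add_monoid R) (add_monoid R)"
      using x b by (intro homI) (auto simp: R.mult_closed R.mult_r_distr)
    fix k k' b' assume k: "k \<in> carrier H" "k' \<in> carrier H" "b' \<in> carrier R"
    then have "(x \<otimes>\<^bsub>R\<^esub> b) \<otimes>\<^bsub>R\<^esub> (((k \<rightharpoonup>\<^bsub>R\<^esub> a) \<otimes>\<^bsub>R\<^esub> b') \<otimes>\<^bsub>R\<^esub> (k' \<rightharpoonup>\<^bsub>R\<^esub> a)) =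
        (x \<otimes>\<^bsub>R\<^esub> (b \<otimes>\<^bsub>R\<^esub> ((k \<rightharpoonup>\<^bsub>R\<^esub> a) \<otimes>\<^bsub>R\<^esub> b'))) \<otimes>\<^bsub>R\<^esub> (k' \<rightharpoonup>\<^bsub>R\<^esub> a)"
      using a x b by (simp add: R.mult_assoc R.mult_closed hact_closed)
    then show "(x \<otimes>\<^bsub>R\<^esub> b) \<otimes>\<^bsub>R\<^esub> (((k \<rightharpoonup>\<^bsub>R\<^esub> a) \<otimes>\<^bsub>R\<^esub> b') \<otimes>\<^bsub>R\<^esub> (k' \<rightharpoonup>\<^bsub>R\<^esub> a)) \<in> ?T"
      using k a b xa by (simp add: R.mult_closed hact_closed)
  qed
  let ?c = "a \<oplus>\<^bsub>R\<^esub> t"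
  have hact_c: "g \<rightharpoonup>\<^bsub>R\<^esub> ?c = (g \<rightharpoonup>\<^bsub>R\<^esub> a) \<oplus>\<^bsub>R\<^esub> (g \<rightharpoonup>\<^bsub>R\<^esub> t)" if "g \<in> carrier H" for g
    using that a T_closed[OF t] by (simp add: hact_r_distr)
  have gt: "g \<rightharpoonup>\<^bsub>R\<^esub> t \<in> ?T" if "g \<in> carrier H" for g
    using sandwich_span_hact[OF a that t] .
  have gc: "g \<rightharpoonup>\<^bsub>R\<^esub> ?c \<in> carrier R" if "g \<in> carrier H" for g
    using that a T_closed[OF t] by (simp add: hact_closed)
  have c_left: "((g \<rightharpoonup>\<^bsub>R\<^esub> ?c) \<otimes>\<^bsub>R\<^esub> b) \<otimes>\<^bsub>R\<^esub> (g' \<rightharpoonup>\<^bsub>R\<^esub> a) \<in> ?T"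
    if "g \<in> carrier H" "g' \<in> carrier H" "b \<in> carrier R" for g g' b
    using that a T_closed[OF gt] memI left[OF gt] R.M.subgroup_a_closed[OF span]
    by (simp add: hact_c R.mult_l_distr R.mult_closed hact_closed)
  have "sandwich H R ?c \<subseteq> ?T"
  proof
    fix s assume "s \<in> sandwich H R ?c"
    then obtain g g' b where g: "g \<in> carrier H" "g' \<in> carrier H" "b \<in> carrier R"
      and s: "s = ((g \<rightharpoonup>\<^bsub>R\<^esub> ?c) \<otimes>\<^bsub>R\<^esub> b) \<otimes>\<^bsub>R\<^esub> (g' \<rightharpoonup>\<^bsub>R\<^esub> ?c)"
      unfolding sandwich_def by blast
    have "s = ((g \<rightharpoonup>\<^bsub>R\<^esub> ?c) \<otimes>\<^bsub>R\<^esub> b) \<otimes>\<^bsub>R\<^esub> (g' \<rightharpoonup>\<^bsub>R\<^esub> a) \<oplus>\<^bsub>R\<^esub>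
        ((g \<rightharpoonup>\<^bsub>R\<^esub> ?c) \<otimes>\<^bsub>R\<^esub> b) \<otimes>\<^bsub>R\<^esub> (g' \<rightharpoonup>\<^bsub>R\<^esub> t)"
      unfolding s hact_c[OF g(2)] using g a gc T_closed[OF gt]
      by (intro R.mult_r_distr) (auto simp: R.mult_closed hact_closed)
    also have "\<dots> \<in> ?T"
      using g by (intro R.M.subgroup_a_closed[OF span c_left right[OF gt _ gc c_left]])
    finally show "s \<in> ?T" .
  qed
  then show ?thesis
    unfolding sandwich_span_def[of H R ?c] by (rule group.generate_subgroup_incl[OF R.M.a_group _ span])
qed

lemma H_regular_element_step:
  assumes a: "a \<in> carrier R" and t: "t \<in> sandwich_span H R a"
    and reg: "H_regular_element H R (a \<oplus>\<^bsub>R\<^esub> t)"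
  shows "H_regular_element H R a"
proof -
  note span = sandwich_span_subgroup[OF a]
  have tc: "t \<in> carrier R"
    using R.M.subgroup_in_carrier[OF span t] .
  then have "a \<oplus>\<^bsub>R\<^esub> t \<in> sandwich_span H R (a \<oplus>\<^bsub>R\<^esub> t)"
    using reg a by (simp add: H_regular_element_iff_span)
  then have "a \<oplus>\<^bsub>R\<^esub> t \<in> sandwich_span H R a"
    using sandwich_span_add[OF a t] by blast
  then have "(a \<oplus>\<^bsub>R\<^esub> t) \<ominus>\<^bsub>R\<^esub> t \<in> sandwich_span H R a"
    using t by (rule R.M.subgroup_minus_closed[OF span])
  moreover have "(a \<oplus>\<^bsub>R\<^esub> t) \<ominus>\<^bsub>R\<^esub> t = a"
    using a tc by (simp add: a_minus_def R.M.a_assoc R.M.r_neg)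
  ultimately show ?thesis
    using a by (simp add: H_regular_element_iff_span)
qed

text \<open>Surjectivity lifts the middle factor from \<open>S\<close> to \<open>R\<close>, so
  generators correspond to generators. This transports regularity down to images and supplies lifts
  of span elements in the quotient.\<close>

lemma sandwich_span_image:
  assumes S: "abelian_group S" and f: "H_hom K H R S f" "f ` carrier R = carrier S"
    and a: "a \<in> carrier R"
  shows "sandwich H S (f a) \<subseteq> carrier S"
    and "sandwich_span H S (f a) = f ` sandwich_span H R a"
proof -
  interpret S: abelian_group S by fact
  have hom: "f \<in> carrier R \<rightarrow> carrier S"
    "\<And>x y. \<lbrakk>x \<in> carrier R; y \<in> carrier R\<rbrakk> \<Longrightarrow> f (x \<oplus>\<^bsub>R\<^esub> y) = f x \<oplus>\<^bsub>S\<^esub> f y"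
    "\<And>x y. \<lbrakk>x \<in> carrier R; y \<in> carrier R\<rbrakk> \<Longrightarrow> f (x \<otimes>\<^bsub>R\<^esub> y) = f x \<otimes>\<^bsub>S\<^esub> f y"
    "\<And>h x. \<lbrakk>h \<in> carrier H; x \<in> carrier R\<rbrakk> \<Longrightarrow> f (h \<rightharpoonup>\<^bsub>R\<^esub> x) = h \<rightharpoonup>\<^bsub>S\<^esub> f x"
    using f by (auto simp: H_hom_def linear_map_def)
  have f_term: "f (((g \<rightharpoonup>\<^bsub>R\<^esub> a) \<otimes>\<^bsub>R\<^esub> b) \<otimes>\<^bsub>R\<^esub> (g' \<rightharpoonup>\<^bsub>R\<^esub> a)) =
      ((g \<rightharpoonup>\<^bsub>S\<^esub> f a) \<otimes>\<^bsub>S\<^esub> f b) \<otimes>\<^bsub>S\<^esub> (g' \<rightharpoonup>\<^bsub>S\<^esub> f a)"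
    if "g \<in> carrier H" "g' \<in> carrier H" "b \<in> carrier R" for g g' b
    using that a hom by (simp add: R.mult_closed hact_closed)
  have img: "sandwich H S (f a) = f ` sandwich H R a"
  proof (intro equalityI subsetI)
    fix s assume "s \<in> sandwich H S (f a)"
    then obtain g g' b where "g \<in> carrier H" "g' \<in> carrier H" "b \<in> carrier R"
      and "s = ((g \<rightharpoonup>\<^bsub>S\<^esub> f a) \<otimes>\<^bsub>S\<^esub> f b) \<otimes>\<^bsub>S\<^esub> (g' \<rightharpoonup>\<^bsub>S\<^esub> f a)"
      unfolding sandwich_def f(2)[symmetric] by blast
    then have "s = f (((g \<rightharpoonup>\<^bsub>R\<^esub> a) \<otimes>\<^bsub>R\<^esub> b) \<otimes>\<^bsub>R\<^esub> (g' \<rightharpoonup>\<^bsub>R\<^esub> a))"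
      "((g \<rightharpoonup>\<^bsub>R\<^esub> a) \<otimes>\<^bsub>R\<^esub> b) \<otimes>\<^bsub>R\<^esub> (g' \<rightharpoonup>\<^bsub>R\<^esub> a) \<in> sandwich H R a"
      unfolding sandwich_def by (simp add: f_term, blast)
    then show "s \<in> f ` sandwich H R a"
      by blast
  next
    fix s assume "s \<in> f ` sandwich H R a"
    then obtain g g' b where g: "g \<in> carrier H" "g' \<in> carrier H" "b \<in> carrier R"
      and "s = f (((g \<rightharpoonup>\<^bsub>R\<^esub> a) \<otimes>\<^bsub>R\<^esub> b) \<otimes>\<^bsub>R\<^esub> (g' \<rightharpoonup>\<^bsub>R\<^esub> a))"
      unfolding sandwich_def by blast
    then have "s = ((g \<rightharpoonup>\<^bsub>S\<^esub> f a) \<otimes>\<^bsub>S\<^esub> f b) \<otimes>\<^bsub>S\<^esub> (g' \<rightharpoonup>\<^bsub>S\<^esub> f a)" "f b \<in> carrier S"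
      using f_term hom(1) by auto
    then show "s \<in> sandwich H S (f a)"
      using g unfolding sandwich_def by blast
  qed
  then show "sandwich H S (f a) \<subseteq> carrier S"
    using sandwich_subset[OF a] f(2) by blast
  interpret f: group_hom "add_monoid R" "add_monoid S" f
    using hom R.M.a_group S.a_group
    by (auto simp: group_hom_def group_hom_axioms_def intro!: homI)
  show "sandwich_span H S (f a) = f ` sandwich_span H R a"
    unfolding sandwich_span_def img
    by (rule f.generate_img) (simp add: sandwich_subset a)
qed

end


subsection \<open>Quotients by \<open>H\<close>-ideals\<close>

text \<open>The group axioms do not see the record extension. This turns the plain monoid record of
  a factor group into the additive group of the richer quotient record.\<close>

lemma comm_group_extend:
  assumes "comm_group \<lparr>carrier = C, mult = m, one = e\<rparr>"
  shows "comm_group \<lparr>carrier = C, mult = m, one = e, \<dots> = z\<rparr>"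
proof -
  interpret comm_group "\<lparr>carrier = C, mult = m, one = e\<rparr>"
    by fact
  show ?thesis
    using m_closed one_closed m_assoc m_comm l_one l_inv_ex by (intro comm_groupI) simp_all
qed

context H_module_algebra
begin

text \<open>Collects what later proofs use about the quotient: its additive group and the surjective
  projection.\<close>

lemma H_quotient_hom:
  assumes N: "H_ideal K H R N"
  shows "abelian_group (H_quotient R N)"
    and "H_hom K H R (H_quotient R N) (\<lambda>x. N +>\<^bsub>R\<^esub> x)"
    and "(\<lambda>x. N +>\<^bsub>R\<^esub> x) ` carrier R = carrier (H_quotient R N)"
proof -
  let ?Q = "H_quotient R N"
  note ideal = R.algebra_idealD[OF algebra_ideal_of_H_ideal[OF N]]
  interpret N: abelian_subgroup N R
    using ideal(1) R.M.abelian_group_axioms by (intro abelian_subgroupI3 additive_subgroupI)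
  have N_carr: "x \<in> carrier R" if "x \<in> N" for x
    using that ideal(2) by blast
  \<comment> \<open>The quotient operations are unions over representatives. Such a union collapses
    to one coset as soon as the operation respects congruence modulo \<open>N\<close>.\<close>
  have coset_const: "(\<Union>y\<in>N +>\<^bsub>R\<^esub> x. N +>\<^bsub>R\<^esub> f y) = N +>\<^bsub>R\<^esub> f x"
    if x: "x \<in> carrier R" and f: "\<And>y. y \<in> carrier R \<Longrightarrow> f y \<in> carrier R"
      and eq: "\<And>n. n \<in> N \<Longrightarrow> f (n \<oplus>\<^bsub>R\<^esub> x) \<in> N +>\<^bsub>R\<^esub> f x" for f x
  proof -
    have "N +>\<^bsub>R\<^esub> f y = N +>\<^bsub>R\<^esub> f x" if "y \<in> N +>\<^bsub>R\<^esub> x" for y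
    proof -
      obtain n where "n \<in> N" "y = n \<oplus>\<^bsub>R\<^esub> x"
        using \<open>y \<in> _\<close> by (auto simp: a_r_coset_def')
      then show ?thesis
        using N.a_repr_independence'[OF eq f[OF x]] by simp
    qed
    moreover have "x \<in> N +>\<^bsub>R\<^esub> x"
      using x by (rule N.a_rcos_self)
    ultimately show ?thesis
      by blast
  qed
  have memI: "y \<in> N +>\<^bsub>R\<^esub> x" if "n \<in> N" "y = n \<oplus>\<^bsub>R\<^esub> x" for n x y
    using that by (auto simp: a_r_coset_def')
  have mult: "rcoset_mult R N (N +>\<^bsub>R\<^esub> x) (N +>\<^bsub>R\<^esub> y) = N +>\<^bsub>R\<^esub> (x \<otimes>\<^bsub>R\<^esub> y)"
    if xy: "x \<in> carrier R" "y \<in> carrier R" for x y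
  proof -
    \<comment> \<open>The product of cosets is a double union, collapsed in the right factor first
      and then in the left.\<close>
    have inner: "(\<Union>v\<in>N +>\<^bsub>R\<^esub> y. N +>\<^bsub>R\<^esub> (u \<otimes>\<^bsub>R\<^esub> v)) = N +>\<^bsub>R\<^esub> (u \<otimes>\<^bsub>R\<^esub> y)"
      if "u \<in> carrier R" for u
    proof (rule coset_const)
      fix n assume n: "n \<in> N"
      show "u \<otimes>\<^bsub>R\<^esub> (n \<oplus>\<^bsub>R\<^esub> y) \<in> N +>\<^bsub>R\<^esub> (u \<otimes>\<^bsub>R\<^esub> y)"
        by (rule memI[of "u \<otimes>\<^bsub>R\<^esub> n"]) (use n xy that ideal(9) N_carr in \<open>auto simp: R.mult_r_distr\<close>)
    qed (use xy that in \<open>auto simp: R.mult_closed\<close>)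
    have "N +>\<^bsub>R\<^esub> x \<subseteq> carrier R"
      using xy(1) by (auto simp: a_r_coset_def' N_carr)
    then have "rcoset_mult R N (N +>\<^bsub>R\<^esub> x) (N +>\<^bsub>R\<^esub> y) =
        (\<Union>u\<in>N +>\<^bsub>R\<^esub> x. N +>\<^bsub>R\<^esub> (u \<otimes>\<^bsub>R\<^esub> y))"
      unfolding rcoset_mult_def by (intro SUP_cong refl inner) blast
    also have "\<dots> = N +>\<^bsub>R\<^esub> (x \<otimes>\<^bsub>R\<^esub> y)"
    proof (rule coset_const)
      fix n assume n: "n \<in> N"
      show "(n \<oplus>\<^bsub>R\<^esub> x) \<otimes>\<^bsub>R\<^esub> y \<in> N +>\<^bsub>R\<^esub> (x \<otimes>\<^bsub>R\<^esub> y)"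
        by (rule memI[of "n \<otimes>\<^bsub>R\<^esub> y"]) (use n xy ideal(8) N_carr in \<open>auto simp: R.mult_l_distr\<close>)
    qed (use xy in \<open>auto simp: R.mult_closed\<close>)
    finally show ?thesis .
  qed
  have smult: "(\<Union>y\<in>N +>\<^bsub>R\<^esub> x. N +>\<^bsub>R\<^esub> (c \<odot>\<^bsub>R\<^esub> y)) = N +>\<^bsub>R\<^esub> (c \<odot>\<^bsub>R\<^esub> x)"
    if "c \<in> carrier K" "x \<in> carrier R" for c x
  proof (rule coset_const)
    fix n assume n: "n \<in> N"
    show "c \<odot>\<^bsub>R\<^esub> (n \<oplus>\<^bsub>R\<^esub> x) \<in> N +>\<^bsub>R\<^esub> (c \<odot>\<^bsub>R\<^esub> x)"
      by (rule memI[of "c \<odot>\<^bsub>R\<^esub> n"]) (use n that ideal(7) N_carr in \<open>auto simp: R.smult_r_distr\<close>)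
  qed (use that in auto)
  have hact: "(\<Union>y\<in>N +>\<^bsub>R\<^esub> x. N +>\<^bsub>R\<^esub> (h \<rightharpoonup>\<^bsub>R\<^esub> y)) = N +>\<^bsub>R\<^esub> (h \<rightharpoonup>\<^bsub>R\<^esub> x)"
    if "h \<in> carrier H" "x \<in> carrier R" for h x
  proof (rule coset_const)
    fix n assume n: "n \<in> N"
    show "h \<rightharpoonup>\<^bsub>R\<^esub> (n \<oplus>\<^bsub>R\<^esub> x) \<in> N +>\<^bsub>R\<^esub> (h \<rightharpoonup>\<^bsub>R\<^esub> x)"
      by (rule memI[of "h \<rightharpoonup>\<^bsub>R\<^esub> n"])
        (use n that H_ideal_hact[OF N] N_carr in \<open>auto simp: hact_r_distr\<close>)
  qed (use that in \<open>auto simp: hact_closed\<close>)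
  show surj: "(\<lambda>x. N +>\<^bsub>R\<^esub> x) ` carrier R = carrier ?Q"
    by (auto simp: H_quotient_def FactRing_def A_RCOSETS_def')
  then show "H_hom K H R ?Q (\<lambda>x. N +>\<^bsub>R\<^esub> x)"
    unfolding H_hom_def linear_map_def
    by (auto simp: H_quotient_def FactRing_def A_RCOSETS_def' mult smult hact N.a_rcos_sum)
  show "abelian_group ?Q"
    using comm_group_extend[OF N.a_factorgroup_is_comm_group[unfolded A_FactGroup_def']]
    by (intro comm_group_abelian_groupI) (simp add: H_quotient_def FactRing_def)
qed

text \<open>The coset of \<open>a\<close> has a representative \<open>t\<close> in
  \<open>T(a)\<close>. Then \<open>a - t\<close> lies in \<open>N\<close>, so it is regular, and
  \<open>H_regular_element_step\<close> applies with \<open>- t\<close>.\<close>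

lemma H_regular_element_lift:
  assumes N: "H_regular_ideal K H R N" and a: "a \<in> carrier R"
    and mem: "N +>\<^bsub>R\<^esub> a \<in> sandwich_span H (H_quotient R N) (N +>\<^bsub>R\<^esub> a)"
  shows "H_regular_element H R a"
proof -
  have N_ideal: "H_ideal K H R N"
    using N by (simp add: H_regular_ideal_def)
  note ideal = R.algebra_idealD[OF algebra_ideal_of_H_ideal[OF N_ideal]]
  interpret N: abelian_subgroup N R
    using ideal(1) R.M.abelian_group_axioms by (intro abelian_subgroupI3 additive_subgroupI)
  note span = sandwich_span_subgroup[OF a]
  obtain t where t: "t \<in> sandwich_span H R a" "N +>\<^bsub>R\<^esub> a = N +>\<^bsub>R\<^esub> t"
    using mem unfolding sandwich_span_image(2)[OF H_quotient_hom[OF N_ideal] a] by blast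
  have tc: "t \<in> carrier R"
    using R.M.subgroup_in_carrier[OF span t(1)] .
  have "a \<oplus>\<^bsub>R\<^esub> \<ominus>\<^bsub>R\<^esub> t \<in> N"
    using t(2) N.a_rcos_self[OF a] a tc by (simp add: N.a_rcos_module)
  then have "H_regular_element H R (a \<oplus>\<^bsub>R\<^esub> \<ominus>\<^bsub>R\<^esub> t)"
    using N by (simp add: H_regular_ideal_def)
  then show ?thesis
    by (rule H_regular_element_step[OF a R.M.subgroup_a_inv_closed[OF span t(1)]])
qed


subsection \<open>The \<open>H\<close>-von Neumann regular radical\<close>

text \<open>An element \<open>x + y\<close> with \<open>x \<in> I\<close> and \<open>y \<in> J\<close> agrees modulo \<open>I\<close> with the \<open>H\<close>-regular \<open>y\<close>.\<close>

lemma H_regular_ideal_sum: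
  assumes I: "H_regular_ideal K H R I" and J: "H_regular_ideal K H R J"
  shows "H_regular_ideal K H R (I <+>\<^bsub>R\<^esub> J)"
  unfolding H_regular_ideal_def
proof (intro conjI ballI)
  have II: "H_ideal K H R I" and JJ: "H_ideal K H R J"
    using I J by (auto simp: H_regular_ideal_def)
  then show "H_ideal K H R (I <+>\<^bsub>R\<^esub> J)"
    by (rule H_ideal_sum)
  note ideal = R.algebra_idealD[OF algebra_ideal_of_H_ideal[OF II]]
  interpret I: abelian_subgroup I R
    using ideal(1) R.M.abelian_group_axioms by (intro abelian_subgroupI3 additive_subgroupI)
  fix a assume "a \<in> I <+>\<^bsub>R\<^esub> J"
  then obtain x y where xy: "x \<in> I" "y \<in> J" and a: "a = x \<oplus>\<^bsub>R\<^esub> y"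
    by (auto simp: set_add_def')
  have carr: "x \<in> carrier R" "y \<in> carrier R"
    using xy II JJ H_ideal_in_carrier by blast+
  have "a \<in> I +>\<^bsub>R\<^esub> y"
    using xy(1) by (auto simp: a a_r_coset_def')
  then have eq: "I +>\<^bsub>R\<^esub> y = I +>\<^bsub>R\<^esub> a"
    using carr(2) by (rule I.a_repr_independence')
  have "H_regular_element H R y"
    using J xy(2) by (simp add: H_regular_ideal_def)
  then have "y \<in> sandwich_span H R y"
    using H_regular_element_iff_span[OF carr(2)] by simp
  then have "I +>\<^bsub>R\<^esub> a \<in> sandwich_span H (H_quotient R I) (I +>\<^bsub>R\<^esub> a)"
    unfolding eq[symmetric] sandwich_span_image(2)[OF H_quotient_hom[OF II] carr(2)] by blast
  then show "H_regular_element H R a"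
    using H_regular_element_lift[OF I, of a] carr by (simp add: a)
qed

lemma H_regular_ideal_zero: "H_regular_ideal K H R {\<zero>\<^bsub>R\<^esub>}"
  using R.M.subgroup_zero_closed[OF sandwich_span_subgroup[OF R.M.zero_closed]]
  by (simp add: H_regular_ideal_def H_ideal_zero H_regular_element_iff_span)

text \<open>The middle factors range over all of \<open>R\<close>, so regularity of an element does
  not depend on the ideal containing it. Hence the ideal generated by \<open>a\<close> inherits
  regularity from any regular ideal that contains \<open>a\<close>.\<close>

lemma r_Hn_eq_Union: "r_Hn K H R = \<Union>{I. H_regular_ideal K H R I}"
proof (intro equalityI subsetI)
  fix a assume "a \<in> r_Hn K H R"
  then have "H_regular_ideal K H R (H_ideal_gen K H R a)" "a \<in> H_ideal_gen K H R a"
    by (auto simp: r_Hn_def H_ideal_gen_def)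
  then show "a \<in> \<Union>{I. H_regular_ideal K H R I}"
    by blast
next
  fix a assume "a \<in> \<Union>{I. H_regular_ideal K H R I}"
  then obtain I where I: "H_regular_ideal K H R I" "a \<in> I"
    by blast
  then have "a \<in> carrier R"
    using H_ideal_in_carrier by (auto simp: H_regular_ideal_def)
  moreover have "H_ideal_gen K H R a \<subseteq> I"
    using I by (auto simp: H_ideal_gen_def H_regular_ideal_def)
  moreover have "\<forall>x\<in>I. H_regular_element H R x"
    using I(1) by (simp add: H_regular_ideal_def)
  ultimately show "a \<in> r_Hn K H R"
    using H_ideal_gen_is_H_ideal[of a] by (auto simp: r_Hn_def H_regular_ideal_def)
qed

lemma H_regular_ideal_subset_r_Hn: "H_regular_ideal K H R I \<Longrightarrow> I \<subseteq> r_Hn K H R"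
  unfolding r_Hn_eq_Union by blast

lemma H_regular_ideal_r_Hn: "H_regular_ideal K H R (r_Hn K H R)"
proof -
  let ?\<I> = "{I. H_regular_ideal K H R I}"
  have ideal: "algebra_ideal K R I" if "I \<in> ?\<I>" for I
    using that by (simp add: H_regular_ideal_def H_ideal_def)
  have "algebra_ideal K R (\<Union>?\<I>)"
  proof (rule R.algebra_ideal_Union_directed[OF _ ideal])
    show "?\<I> \<noteq> {}"
      using H_regular_ideal_zero by blast
    fix I J assume IJ: "I \<in> ?\<I>" "J \<in> ?\<I>"
    then have "I <+>\<^bsub>R\<^esub> J \<in> ?\<I>"
      using H_regular_ideal_sum by simp
    then show "\<exists>L\<in>?\<I>. I \<subseteq> L \<and> J \<subseteq> L"
      using R.ideal_sum_supset[OF ideal[OF IJ(1)] ideal[OF IJ(2)]] by blast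
  qed
  moreover have "h \<rightharpoonup>\<^bsub>R\<^esub> x \<in> \<Union>?\<I>" if "h \<in> carrier H" "x \<in> \<Union>?\<I>" for h x
    using that H_ideal_hact unfolding H_regular_ideal_def by blast
  ultimately have "H_ideal K H R (\<Union>?\<I>)"
    unfolding H_ideal_def by blast
  moreover have "H_regular_element H R a" if "a \<in> \<Union>?\<I>" for a
    using that by (auto simp: H_regular_ideal_def)
  ultimately show ?thesis
    unfolding r_Hn_eq_Union H_regular_ideal_def[of K H R "\<Union>_"] by blast
qed

text \<open>The preimage of \<open>J\<close> consists of elements that are regular modulo the
  regular ideal \<open>r_Hn\<close>, hence regular. By maximality it lies in \<open>r_Hn\<close>, so
  every coset in \<open>J\<close> is the zero coset.\<close>

lemma H_regular_ideal_quotient_r_Hn: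
  assumes J: "H_regular_ideal K H (H_quotient R (r_Hn K H R)) J"
  shows "J = {\<zero>\<^bsub>H_quotient R (r_Hn K H R)\<^esub>}"
proof -
  let ?N = "r_Hn K H R"
  let ?Q = "H_quotient R ?N"
  have N: "H_ideal K H R ?N"
    using H_regular_ideal_r_Hn by (simp add: H_regular_ideal_def)
  note hom = H_quotient_hom[OF N]
  interpret Q: abelian_group ?Q by (rule hom(1))
  interpret N: abelian_subgroup ?N R
    using R.algebra_idealD(1)[OF algebra_ideal_of_H_ideal[OF N]] R.M.abelian_group_axioms
    by (intro abelian_subgroupI3 additive_subgroupI)
  have J_ideal: "H_ideal K H ?Q J"
    using J by (simp add: H_regular_ideal_def)
  then have J_group: "subgroup J (add_monoid ?Q)"
    by (auto simp: H_ideal_def algebra_ideal_def intro: submodule.axioms)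
  let ?I = "{x \<in> carrier R. ?N +>\<^bsub>R\<^esub> x \<in> J}"
  have "H_regular_element H R a" if "a \<in> ?I" for a
  proof -
    have a: "a \<in> carrier R" "?N +>\<^bsub>R\<^esub> a \<in> J"
      using that by auto
    then have "?N +>\<^bsub>R\<^esub> a \<in> sandwich_span H ?Q (?N +>\<^bsub>R\<^esub> a)"
      using J sandwich_span_image(1)[OF hom a(1)]
      by (intro H_regular_element_imp_span[OF hom(1)]) (auto simp: H_regular_ideal_def)
    then show ?thesis
      by (rule H_regular_element_lift[OF H_regular_ideal_r_Hn a(1)])
  qed
  then have "H_regular_ideal K H R ?I"
    using H_ideal_vimage[OF hom(1,2) J_ideal] by (simp add: H_regular_ideal_def)
  then have I_sub: "?I \<subseteq> ?N"
    by (rule H_regular_ideal_subset_r_Hn)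
  have zero: "\<zero>\<^bsub>?Q\<^esub> = ?N"
    by (simp add: H_quotient_def FactRing_def)
  have "X = ?N" if X: "X \<in> J" for X
  proof -
    obtain x where x: "x \<in> carrier R" "X = ?N +>\<^bsub>R\<^esub> x"
      using Q.subgroup_in_carrier[OF J_group X] hom(3) by blast
    then have "x \<in> ?N"
      using I_sub X by blast
    then show ?thesis
      using x(2) N.a_rcos_const by simp
  qed
  moreover have "?N \<in> J"
    using Q.subgroup_zero_closed[OF J_group] unfolding zero .
  ultimately show ?thesis
    unfolding zero by blast
qed

text \<open>By maximality it is enough that \<open>r_nH\<close> is a regular \<open>H\<close>-ideal.
  It absorbs products because each Sweedler summand of \<open>h . (x r)\<close> has a factor
  \<open>h1 . x\<close> in the ideal \<open>r_n\<close>, and it is \<open>H\<close>-stable because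
  \<open>g . (h . x) = (g h) . x\<close>.\<close>

lemma r_nH_subset_r_Hn: "r_nH K H R \<subseteq> r_Hn K H R"
proof (rule H_regular_ideal_subset_r_Hn)
  let ?N = "r_n K R" and ?I = "r_nH K H R"
  have N: "algebra_ideal K R ?N" and N_reg: "\<And>a. a \<in> ?N \<Longrightarrow> \<exists>b\<in>carrier R. a = (a \<otimes>\<^bsub>R\<^esub> b) \<otimes>\<^bsub>R\<^esub> a"
    using R.vN_regular_ideal_r_n by (auto simp: vN_regular_ideal_def)
  note ideal = R.algebra_idealD[OF N]
  have memI: "x \<in> ?I" if "x \<in> carrier R" "\<And>h. h \<in> carrier H \<Longrightarrow> h \<rightharpoonup>\<^bsub>R\<^esub> x \<in> ?N" for x
    using that by (simp add: r_nH_def)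
  have I_carr: "x \<in> carrier R" if "x \<in> ?I" for x
    using that by (simp add: r_nH_def)
  have I_hact: "h \<rightharpoonup>\<^bsub>R\<^esub> x \<in> ?N" if "h \<in> carrier H" "x \<in> ?I" for h x
    using that by (simp add: r_nH_def)
  have "algebra_ideal K R ?I"
  proof (rule R.algebra_idealI)
    show "?I \<subseteq> carrier R"
      using I_carr by blast
    show "\<zero>\<^bsub>R\<^esub> \<in> ?I"
      using ideal(3) by (intro memI) (auto simp: hact_zero)
  next
    fix x y assume "x \<in> ?I" "y \<in> ?I"
    then show "x \<oplus>\<^bsub>R\<^esub> y \<in> ?I"
      using ideal(5) I_carr I_hact by (intro memI) (auto simp: hact_r_distr)
  next
    fix c x assume "c \<in> carrier K" "x \<in> ?I"
    then show "c \<odot>\<^bsub>R\<^esub> x \<in> ?I"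
      using ideal(7) I_carr I_hact by (intro memI) (auto simp: hact_smult_right)
  next
    fix x r assume x: "x \<in> ?I" and r: "r \<in> carrier R"
    note xc = I_carr[OF x]
    show "x \<otimes>\<^bsub>R\<^esub> r \<in> ?I"
      by (rule memI[OF R.mult_closed[OF xc r]], rule hact_prod_in_subgroup[OF _ xc r ideal(1)])
        (simp_all add: ideal(8) I_hact x r hact_closed)
    show "r \<otimes>\<^bsub>R\<^esub> x \<in> ?I"
      by (rule memI[OF R.mult_closed[OF r xc]], rule hact_prod_in_subgroup[OF _ r xc ideal(1)])
        (simp_all add: ideal(9) I_hact x r hact_closed)
  qed
  then have "H_ideal K H R ?I"
    unfolding H_ideal_def
  proof (intro conjI ballI)
    fix h x assume h: "h \<in> carrier H" and x: "x \<in> ?I"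
    show "h \<rightharpoonup>\<^bsub>R\<^esub> x \<in> ?I"
    proof (rule memI)
      fix g assume "g \<in> carrier H"
      then show "g \<rightharpoonup>\<^bsub>R\<^esub> (h \<rightharpoonup>\<^bsub>R\<^esub> x) \<in> ?N"
        using h I_hact[OF H.m_closed x] hact_mult I_carr[OF x] by simp
    qed (use h I_carr[OF x] in \<open>simp add: hact_closed\<close>)
  qed
  moreover have "H_regular_element H R a" if a: "a \<in> ?I" for a
  proof -
    have carr: "a \<in> carrier R"
      using a by (rule I_carr)
    then have "a \<in> ?N"
      using I_hact[OF H.one_closed a] by (simp add: hact_one)
    then obtain b where b: "b \<in> carrier R" "a = (a \<otimes>\<^bsub>R\<^esub> b) \<otimes>\<^bsub>R\<^esub> a"
      using N_reg by blast
    \<comment> \<open>The unit of \<open>H\<close> acts trivially, which makes \<open>a b a\<close>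
      a single sandwich product.\<close>
    then have "a = ((\<one>\<^bsub>H\<^esub> \<rightharpoonup>\<^bsub>R\<^esub> a) \<otimes>\<^bsub>R\<^esub> b) \<otimes>\<^bsub>R\<^esub> (\<one>\<^bsub>H\<^esub> \<rightharpoonup>\<^bsub>R\<^esub> a)"
      using carr by (simp add: hact_one)
    then have "a \<in> sandwich H R a"
      using b(1) H.one_closed unfolding sandwich_def by blast
    then show ?thesis
      using carr by (simp add: H_regular_element_iff_span sandwich_span_def generate.incl)
  qed
  ultimately show "H_regular_ideal K H R ?I"
    by (simp add: H_regular_ideal_def)
qed

lemma H_regular_algebra_image:
  assumes S: "H_module_algebra K H \<Delta> S" and f: "H_hom K H R S f" "f ` carrier R = carrier S"
    and reg: "H_regular_algebra H R"
  shows "H_regular_algebra H S"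
  unfolding H_regular_algebra_def
proof
  interpret S: H_module_algebra K H \<Delta> S by fact
  fix y assume y: "y \<in> carrier S"
  then obtain x where x: "x \<in> carrier R" "y = f x"
    using f(2) by blast
  have "x \<in> sandwich_span H R x"
    using reg x(1) H_regular_element_iff_span by (simp add: H_regular_algebra_def)
  then have "y \<in> sandwich_span H S y"
    using sandwich_span_image(2)[OF S.R.M.abelian_group_axioms f x(1)] x(2) by blast
  then show "H_regular_element H S y"
    using S.H_regular_element_iff_span[OF y] by simp
qed

end

theorem corollary3p7:
  fixes K :: "('k, 'a) ring_scheme"
    and H :: "('k, 'h, 'b) module_scheme"
    and \<Delta> :: "'h \<Rightarrow> ('h \<times> 'h \<Rightarrow>\<^sub>0 int) set"
  assumes "comult_algebra K H \<Delta>"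
  shows
    "(\<forall>(R :: ('k, 'h, 'r, 'c) hmodule_scheme) (S :: ('k, 'h, 's, 'd) hmodule_scheme) f.
        H_module_algebra K H \<Delta> R \<and> H_module_algebra K H \<Delta> S \<and>
        H_hom K H R S f \<and> f ` carrier R = carrier S \<and> H_regular_algebra H R
        \<longrightarrow> H_regular_algebra H S) \<and>
     (\<forall>R :: ('k, 'h, 'r, 'c) hmodule_scheme. H_module_algebra K H \<Delta> R \<longrightarrow>
        H_regular_ideal K H R (r_Hn K H R) \<and>
        (\<forall>I. H_regular_ideal K H R I \<longrightarrow> I \<subseteq> r_Hn K H R)) \<and>
     (\<forall>R :: ('k, 'h, 'r, 'c) hmodule_scheme. H_module_algebra K H \<Delta> R \<longrightarrow>
        (\<forall>J. H_regular_ideal K H (H_quotient R (r_Hn K H R)) J \<longrightarrow>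
          J = {\<zero>\<^bsub>H_quotient R (r_Hn K H R)\<^esub>})) \<and>
     (\<forall>R :: ('k, 'h, 'r, 'c) hmodule_scheme. H_module_algebra K H \<Delta> R \<longrightarrow>
        r_nH K H R \<subseteq> r_Hn K H R)"
proof (intro conjI allI impI; (elim conjE)?)
  fix R :: "('k, 'h, 'r, 'c) hmodule_scheme" and S :: "('k, 'h, 's, 'd) hmodule_scheme" and f
  assume "H_module_algebra K H \<Delta> R" "H_module_algebra K H \<Delta> S"
    "H_hom K H R S f" "f ` carrier R = carrier S" "H_regular_algebra H R"
  then show "H_regular_algebra H S"
    by (rule H_module_algebra.H_regular_algebra_image)
next
  fix R :: "('k, 'h, 'r, 'c) hmodule_scheme"
  assume R: "H_module_algebra K H \<Delta> R"
  note radical = H_module_algebra.H_regular_ideal_r_Hn[OF R]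
    H_module_algebra.H_regular_ideal_subset_r_Hn[OF R]
    H_module_algebra.r_nH_subset_r_Hn[OF R]
  show "H_regular_ideal K H R (r_Hn K H R)" "r_nH K H R \<subseteq> r_Hn K H R"
    by (fact radical)+
  fix I assume "H_regular_ideal K H R I"
  then show "I \<subseteq> r_Hn K H R"
    by (rule radical)
next
  fix R :: "('k, 'h, 'r, 'c) hmodule_scheme" and J
  assume "H_module_algebra K H \<Delta> R" "H_regular_ideal K H (H_quotient R (r_Hn K H R)) J"
  then show "J = {\<zero>\<^bsub>H_quotient R (r_Hn K H R)\<^esub>}"
    by (rule H_module_algebra.H_regular_ideal_quotient_r_Hn)
qed

end
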